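(* Let $A(z,x)=\dfrac{z-1}{z-e^{x(z-1)}}$. Then, with $P_{\mathcal{A}_0}=P_{\mathcal{B}_0}=P_{\mathcal{D}_0}=1$ and $P_{\mathcal{D}_1}(z):=0$, \[\sum_{n\ge0}P_{\mathcal{A}_n}(z)\frac{x^n}{n!}=1+\log A(z,x),\qquad \sum_{n\ge0}P_{\mathcal{B}_n}(z)\frac{x^n}{n!}=e^{x(z-1)}A(z,2x)^{1/2},\] \[\sum_{n\ge0}P_{\mathcal{D}_n}(z)\frac{x^n}{n!}=\big(e^{x(z-1)}-zx\big)A(z,2x)^{1/2}.\]
   Context: For a linear hyperplane arrangement $\mathcal{A}$, $P_{\mathcal{A}}(z)=\sum_{\mathrm{X}}|\mu(\bot,\mathrm{X})|(z-1)^{\operatorname{codim}\mathrm{X}}$, summed over flats (intersections of subsets of hyperplanes), $\mu$ the Möbius function of the lattice of flats under inclusion, $\bot$ its minimum. $\mathcal{A}_n$ is the braid arrangement in $\mathbb{R}^n$: hyperplanes $x_i=x_j$, $1\le i<j\le n$. $\mathcal{B}_n$ in $\mathbb{R}^n$: hyperplanes $x_i=\pm x_j$ ($i<j$) and $x_i=0$. $\mathcal{D}_n$ in $\mathbb{R}^n$ ($n\ge2$): hyperplanes $x_i=\pm x_j$ ($i<j$). *)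

theory Defs
  imports "HOL-Computational_Algebra.Computational_Algebra" "HOL-Library.Function_Algebras"
begin

section \<open>Linear algebra on R^n, modelled as functions nat => real vanishing from index n on\<close>

definition fscale :: "real \<Rightarrow> (nat \<Rightarrow> real) \<Rightarrow> (nat \<Rightarrow> real)" where
  "fscale c v = (\<lambda>i. c * v i)"

definition vdim :: "(nat \<Rightarrow> real) set \<Rightarrow> nat" where
  "vdim X = vector_space.dim fscale X"

definition ambient :: "nat \<Rightarrow> (nat \<Rightarrow> real) set" where
  "ambient n = {v. \<forall>i\<ge>n. v i = 0}"

function mobius :: "'a set set \<Rightarrow> 'a set \<Rightarrow> 'a set \<Rightarrow> int" where
  "mobius F x y =
     (if finite F \<and> x \<subset> y then - (\<Sum>z\<in>{z\<in>F. x \<subseteq> z \<and> z \<subset> y}. mobius F x z)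
      else if x = y then 1 else 0)"
  by pat_completeness auto
termination
proof (relation "measure (\<lambda>(F,x,y). card {w\<in>F. w \<subset> y})")
  fix F :: "'a set set" and x y z
  assume a: "finite F \<and> x \<subset> y" and z: "z \<in> {z\<in>F. x \<subseteq> z \<and> z \<subset> y}"
  have "{w\<in>F. w \<subset> z} \<subset> {w\<in>F. w \<subset> y}" using z by auto
  then have "card {w\<in>F. w \<subset> z} < card {w\<in>F. w \<subset> y}"
    using a by (intro psubset_card_mono) auto
  then show "((F, x, z), F, x, y) \<in> measure (\<lambda>(F,x,y). card {w\<in>F. w \<subset> y})" by simp
qed auto

(* flats: intersections of subsets of hyperplanes (empty intersection = R^n) *)
definition flats :: "nat \<Rightarrow> (nat \<Rightarrow> real) set set \<Rightarrow> (nat \<Rightarrow> real) set set" where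
  "flats n A = {ambient n \<inter> \<Inter>S | S. S \<subseteq> A}"

definition charP :: "nat \<Rightarrow> (nat \<Rightarrow> real) set set \<Rightarrow> real poly" where
  "charP n A = (\<Sum>X\<in>flats n A.
      of_int \<bar>mobius (flats n A) (ambient n \<inter> \<Inter>A) X\<bar> * [:-1, 1:] ^ (n - vdim X))"

definition arrA :: "nat \<Rightarrow> (nat \<Rightarrow> real) set set" where
  "arrA n = {{v\<in>ambient n. v i = v j} | i j. i < j \<and> j < n}"

definition arrB :: "nat \<Rightarrow> (nat \<Rightarrow> real) set set" where
  "arrB n = {{v\<in>ambient n. v i = v j} | i j. i < j \<and> j < n}
          \<union> {{v\<in>ambient n. v i = - v j} | i j. i < j \<and> j < n}
          \<union> {{v\<in>ambient n. v i = 0} | i. i < n}"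

definition arrD :: "nat \<Rightarrow> (nat \<Rightarrow> real) set set" where
  "arrD n = {{v\<in>ambient n. v i = v j} | i j. i < j \<and> j < n}
          \<union> {{v\<in>ambient n. v i = - v j} | i j. i < j \<and> j < n}"

definition PA :: "nat \<Rightarrow> real poly" where
  "PA n = (if n = 0 then 1 else charP n (arrA n))"

definition PB :: "nat \<Rightarrow> real poly" where
  "PB n = (if n = 0 then 1 else charP n (arrB n))"

definition PD :: "nat \<Rightarrow> real poly" where
  "PD n = (if n = 0 then 1 else if n = 1 then 0 else charP n (arrD n))"

type_synonym coef = "real poly fract"

definition zvar :: coef where "zvar = to_fract [:0, 1:]"

definition egf :: "(nat \<Rightarrow> real poly) \<Rightarrow> coef fps" where
  "egf f = Abs_fps (\<lambda>n. to_fract (f n) / of_nat (fact n))"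

(* A(z, c x) = (z - 1) / (z - e^{c x (z - 1)}) *)
definition Afun :: "coef \<Rightarrow> coef fps" where
  "Afun c = fps_const (zvar - 1) / (fps_const zvar - fps_exp (c * (zvar - 1)))"

(* log F := ln(1 + (F - 1)), and F^(1/2) := (1 + (F - 1))^(1/2), for F with constant term 1 *)
definition fps_log :: "coef fps \<Rightarrow> coef fps" where
  "fps_log F = fps_ln 1 oo (F - 1)"

definition fps_sqrt :: "coef fps \<Rightarrow> coef fps" where
  "fps_sqrt F = fps_binomial (1/2) oo (F - 1)"

end

theory Submission
  imports Defs
begin

text \<open>Give each coordinate one of \<open>t\<close> values: \<open>{1..q}\<close> for the braid arrangement, \<open>{-q..q}\<close> for types B
  and D. A flat \<open>X\<close> contains \<open>t^dim X\<close> of these points, and the number of points whose least flat is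
  \<open>Y\<close> is a polynomial \<open>p_Y(t)\<close>, so \<open>\<Sum>Y\<subseteq>X. p_Y(t) = t^dim X\<close>. Comparing the coefficients of \<open>t^d\<close>,
  where \<open>d\<close> is the dimension of the least flat \<open>\<bottom>\<close>, shows that \<open>\<mu>(\<bottom>,Y)\<close> is the coefficient of \<open>t^d\<close>
  in \<open>p_Y\<close>: up to sign \<open>(k-1)!\<close> for the braid arrangement and \<open>(2k-1)!!\<close> for type B, \<open>k = dim Y\<close>.
  For \<open>X\<close> the whole space the same identity determines the number of flats of each dimension,
  hence the generating functions.

  A type B flat fails to be a type D flat exactly when its generic point has a single zero
  coordinate, and its type D closure then has one dimension more. So \<open>p_X\<close> for type D is a sum of
  type B polynomials, and the correction to the type B series is obtained by counting the
  points with exactly one zero coordinate.\<close>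

subsection \<open>Formal power series\<close>

text \<open>\<open>u ^ k\<close> starts in degree at least \<open>k\<close>, so cutting the
  composition off at \<open>k = n\<close> changes no coefficient up to the \<open>n\<close>-th; the
  factor \<open>E\<close> then passes through the finite sum.\<close>

lemma fps_mult_compose_nth:
  fixes E H u :: "'a::field fps"
  assumes "u $ 0 = 0"
  shows "(E * (H oo u)) $ n = (\<Sum>k\<le>n. H $ k * (E * u ^ k) $ n)"
proof -
  have *: "(H oo u) $ m = (\<Sum>k\<le>n. H $ k * (u ^ k) $ m)" if "m \<le> n" for m
    unfolding fps_compose_nth atLeast0AtMost
    using that startsby_zero_power_prefix[OF assms]
    by (intro sum.mono_neutral_left) auto
  have "(E * (H oo u)) $ n = (\<Sum>i=0..n. E $ i * (\<Sum>k\<le>n. H $ k * (u ^ k) $ (n - i)))"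
    unfolding fps_mult_nth by (intro sum.cong refl) (simp add: *)
  also have "\<dots> = (\<Sum>k\<le>n. \<Sum>i=0..n. H $ k * (E $ i * (u ^ k) $ (n - i)))"
    unfolding sum_distrib_left by (subst sum.swap) (simp add: algebra_simps)
  also have "\<dots> = (\<Sum>k\<le>n. H $ k * (E * u ^ k) $ n)"
    by (simp add: fps_mult_nth sum_distrib_left)
  finally show ?thesis .
qed

text \<open>The system is triangular with diagonal entries \<open>c ^ q * fact q\<close>, which are
  nonzero, so the unknowns are determined one after the other.\<close>

lemma binomial_transform_unique:
  fixes N M :: "nat \<Rightarrow> 'a::field_char_0"
  assumes "c \<noteq> 0"
    and eq: "\<And>q. (\<Sum>k\<le>q. N k * (c ^ k * fact k * of_nat (q choose k)))
                = (\<Sum>k\<le>q. M k * (c ^ k * fact k * of_nat (q choose k)))"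
  shows "N k = M k"
proof (induction k rule: less_induct)
  case (less q)
  have "(\<Sum>k<q. N k * (c ^ k * fact k * of_nat (q choose k)))
      = (\<Sum>k<q. M k * (c ^ k * fact k * of_nat (q choose k)))"
    by (intro sum.cong) (auto simp: less)
  then show ?case
    using eq[of q] \<open>c \<noteq> 0\<close> by (simp flip: lessThan_Suc_atMost)
qed

text \<open>Binomial theorem for \<open>((fps_exp c - 1) + 1) ^ q\<close>: a product with
  \<open>fps_exp (of_nat q * c)\<close> becomes a binomial transform in \<open>q\<close>.\<close>

lemma sum_binomial_fps_exp_power:
  fixes E :: "'a::field_char_0 fps"
  shows "(\<Sum>k\<le>q. E * (fps_exp c - 1) ^ k * fps_const (of_nat (q choose k)))
       = E * fps_exp (of_nat q * c)"
proof -
  have "fps_exp (of_nat q * c) = ((fps_exp c - 1) + 1) ^ q"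
    by (simp add: fps_exp_power_mult)
  also have "\<dots> = (\<Sum>k\<le>q. of_nat (q choose k) * (fps_exp c - 1) ^ k)"
    by (subst binomial_ring) simp
  finally show ?thesis
    by (simp add: sum_distrib_left algebra_simps fps_of_nat)
qed

text \<open>The hypothesis determines the number of members of dimension \<open>k\<close>: by the binomial theorem
  it must be \<open>n!/k!\<close> times the \<open>n\<close>-th coefficient of \<open>E * ((fps_exp c - 1)/c)^k\<close>.\<close>

lemma weighted_count_eq_fps_nth:
  fixes E :: "'a::field_char_0 fps" and d :: "'b \<Rightarrow> nat"
  assumes "finite F" and le: "\<And>Y. Y \<in> F \<Longrightarrow> d Y \<le> n" and c: "c > 0" and w: "w \<noteq> 0"
    and count: "\<And>q. of_nat (\<Sum>Y\<in>F. c ^ d Y * fact (d Y) * (q choose d Y))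
                 = fact n * (E * fps_exp (of_nat (c * q))) $ n"
  shows "(\<Sum>Y\<in>F. of_nat (\<beta> (d Y)) * w ^ (n - d Y)) / fact n
     = ((E oo (fps_const w * fps_X)) * (Abs_fps (\<lambda>k. of_nat (\<beta> k) / fact k) oo
          (fps_const (1 / (of_nat c * w)) * (fps_exp (of_nat c * w) - 1)))) $ n"
proof -
  define N where "N k = card {Y \<in> F. d Y = k}" for k
  define G where "G = fps_exp (of_nat c :: 'a) - 1"
  define u where "u = fps_const (1 / (of_nat c * w)) * (fps_exp (of_nat c * w) - 1)"
  have c0: "(of_nat c :: 'a) \<noteq> 0" using c by simp
  \<comment> \<open>Grouping by dimension, over an arbitrary semiring because it serves both the
    counts in \<open>nat\<close> and the weights in the field.\<close>
  have sumN: "(\<Sum>Y\<in>F. g (d Y)) = (\<Sum>k\<in>K. of_nat (N k) * g k)"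
    if "finite K" "\<And>Y. Y \<in> F \<Longrightarrow> d Y \<notin> K \<Longrightarrow> g (d Y) = 0"
    for g :: "nat \<Rightarrow> 'c::comm_semiring_1" and K
  proof -
    have "(\<Sum>Y\<in>F. g (d Y)) = (\<Sum>Y\<in>{Y\<in>F. d Y \<in> K}. g (d Y))"
      using that assms(1) by (intro sum.mono_neutral_right) auto
    also have "\<dots> = (\<Sum>k\<in>K. \<Sum>Y\<in>{Y\<in>{Y\<in>F. d Y \<in> K}. d Y = k}. g (d Y))"
      using that(1) assms(1) by (intro sum.group[symmetric]) auto
    also have "\<dots> = (\<Sum>k\<in>K. of_nat (N k) * g k)"
    proof (intro sum.cong refl)
      fix k assume "k \<in> K"
      then have "{Y\<in>{Y\<in>F. d Y \<in> K}. d Y = k} = {Y\<in>F. d Y = k}" by auto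
      then show "(\<Sum>Y\<in>{Y\<in>{Y\<in>F. d Y \<in> K}. d Y = k}. g (d Y)) = of_nat (N k) * g k"
        by (simp add: N_def)
    qed
    finally show ?thesis .
  qed
  have N: "of_nat (N k) = fact n * (E * G ^ k) $ n / (of_nat c ^ k * fact k)" for k
  proof (rule binomial_transform_unique[OF c0])
    fix q
    have "(\<Sum>k\<le>q. of_nat (N k) * (of_nat c ^ k * fact k * of_nat (q choose k)))
        = (of_nat (\<Sum>k\<le>q. N k * (c ^ k * fact k * (q choose k))) :: 'a)"
      by simp
    also have "(\<Sum>k\<le>q. N k * (c ^ k * fact k * (q choose k)))
       = (\<Sum>Y\<in>F. c ^ d Y * fact (d Y) * (q choose d Y))"
      using sumN[of "{..q}" "\<lambda>k. c ^ k * fact k * (q choose k)"] by auto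
    also have "of_nat \<dots> = fact n * (E * fps_exp (of_nat q * of_nat c)) $ n"
      by (simp only: count) (simp add: mult.commute)
    also have "\<dots> = (\<Sum>k\<le>q. fact n * ((E * G ^ k) $ n * of_nat (q choose k)))"
      unfolding sum_binomial_fps_exp_power[symmetric] G_def
      by (simp add: fps_sum_nth sum_distrib_left)
    also have "\<dots> = (\<Sum>k\<le>q. fact n * (E * G ^ k) $ n / (of_nat c ^ k * fact k)
                       * (of_nat c ^ k * fact k * of_nat (q choose k)))"
      using c0 by (intro sum.cong refl) simp
    finally show "(\<Sum>k\<le>q. of_nat (N k) * (of_nat c ^ k * fact k * of_nat (q choose k)))
       = (\<Sum>k\<le>q. fact n * (E * G ^ k) $ n / (of_nat c ^ k * fact k)
                       * (of_nat c ^ k * fact k * of_nat (q choose k)))" .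
  qed
  \<comment> \<open>Substituting \<open>w * X\<close> for \<open>X\<close> multiplies the
    \<open>n\<close>-th coefficient by \<open>w ^ n\<close> and turns \<open>G\<close> into
    \<open>c * w\<close> times \<open>u\<close>.\<close>
  have scale: "((E oo (fps_const w * fps_X)) * u ^ k) $ n * (of_nat c * w) ^ k = w ^ n * (E * G ^ k) $ n" for k
  proof -
    have "fps_const ((of_nat c * w) ^ k) * u ^ k = (fps_exp (of_nat c * w) - 1) ^ k"
      using c0 w unfolding u_def power_mult_distrib
      by (simp add: fps_const_power power_divide mult.assoc[symmetric] power_mult_distrib)
    also have "\<dots> = G ^ k oo (fps_const w * fps_X)"
      unfolding G_def
      by (subst fps_compose_power[symmetric]) (simp_all add: fps_compose_sub_distrib mult.commute[of "of_nat c" w])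
    finally have "((E oo (fps_const w * fps_X)) * u ^ k) * fps_const ((of_nat c * w) ^ k)
        = (E * G ^ k) oo (fps_const w * fps_X)"
      by (simp add: fps_compose_mult_distrib mult_ac)
    then have "(((E oo (fps_const w * fps_X)) * u ^ k) * fps_const ((of_nat c * w) ^ k)) $ n
        = w ^ n * (E * G ^ k) $ n"
      by (simp add: fps_compose_linear)
    then show ?thesis by simp
  qed
  have "(\<Sum>Y\<in>F. of_nat (\<beta> (d Y)) * w ^ (n - d Y)) / fact n
      = (\<Sum>k\<le>n. of_nat (N k) * (of_nat (\<beta> k) * w ^ (n - k))) / fact n"
    by (subst sumN[of "{..n}" "\<lambda>k. of_nat (\<beta> k) * w ^ (n - k)"]) (use le in auto)
  also have "\<dots> = (\<Sum>k\<le>n. of_nat (\<beta> k) / fact k * ((E oo (fps_const w * fps_X)) * u ^ k) $ n)"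
    unfolding sum_divide_distrib
  proof (intro sum.cong refl)
    \<comment> \<open>Here \<open>k \<le> n\<close> matters: only then does \<open>w ^ n\<close>
      split as \<open>w ^ (n - k) * w ^ k\<close>.\<close>
    fix k assume "k \<in> {..n}"
    then have "w ^ n = w ^ (n - k) * w ^ k" by (simp flip: power_add)
    then have *: "((E oo (fps_const w * fps_X)) * u ^ k) $ n * of_nat c ^ k = w ^ (n - k) * (E * G ^ k) $ n"
      using scale[of k] w by (simp add: power_mult_distrib mult_ac)
    have "((E oo (fps_const w * fps_X)) * u ^ k) $ n = w ^ (n - k) * (E * G ^ k) $ n / of_nat c ^ k"
      using c0 by (simp flip: *)
    then show "of_nat (N k) * (of_nat (\<beta> k) * w ^ (n - k)) / fact n
       = of_nat (\<beta> k) / fact k * ((E oo (fps_const w * fps_X)) * u ^ k) $ n"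
      by (simp add: N mult_ac)
  qed
  also have "\<dots> = ((E oo (fps_const w * fps_X)) * (Abs_fps (\<lambda>k. of_nat (\<beta> k) / fact k) oo u)) $ n"
    by (subst fps_mult_compose_nth) (simp_all add: u_def)
  finally show ?thesis by (simp add: u_def)
qed

lemma fps_eqI_deriv:
  fixes f g :: "'a::field_char_0 fps"
  assumes "fps_deriv f = fps_deriv g" "f $ 0 = g $ 0"
  shows "f = g"
proof -
  have "f = fps_const (f $ 0 - g $ 0) + g" using assms(1) fps_deriv_eq_iff by blast
  then show ?thesis unfolding assms(2) by simp
qed

text \<open>With \<open>A = 1/(1 - u)\<close>, both sides are \<open>- log (1 - u)\<close>, the sum
  of \<open>u ^ k / k\<close>. They have constant term 0 and the same derivative
  \<open>A * fps_deriv u\<close>.\<close>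

lemma fps_ln_compose_geometric:
  fixes u :: "'a::field_char_0 fps"
  assumes u0: "u $ 0 = 0" and A: "A * (1 - u) = 1"
  shows "fps_ln 1 oo (A - 1) = Abs_fps (\<lambda>k. of_nat (if k = 0 then 0 else fact (k - 1)) / fact k) oo u"
    (is "_ = ?H oo u")
proof (rule fps_eqI_deriv)
  have "A $ 0 * (1 - u) $ 0 = 1" using arg_cong[OF A, of "\<lambda>f. f $ 0"] by simp
  then have A0: "(A - 1) $ 0 = 0" using u0 by simp
  have uniq: "x = y" if "x * z = 1" "y * z = 1" for x y z :: "'a fps"
    using that by (metis mult_right_cancel mult_zero_right zero_neq_one)
  have H: "fps_deriv ?H * (1 - fps_X) = 1"
  proof (rule fps_ext)
    fix n
    have d: "fps_deriv ?H $ k = 1" for k by (simp del: of_nat_Suc)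
    show "(fps_deriv ?H * (1 - fps_X)) $ n = 1 $ n"
      by (cases n) (simp_all add: right_diff_distrib d del: fps_deriv_nth)
  qed
  have "(fps_deriv ?H oo u) * (1 - u) = 1"
    using arg_cong[OF H, of "\<lambda>f. f oo u"] u0
    by (simp add: fps_compose_mult_distrib fps_compose_sub_distrib)
  then have H': "fps_deriv ?H oo u = A" using A by (rule uniq)
  have "inverse (1 + fps_X) * (1 + fps_X :: 'a fps) = 1" by (simp add: inverse_mult_eq_1)
  from arg_cong[OF this, of "\<lambda>f. f oo (A - 1)"]
  have "(inverse (1 + fps_X) oo (A - 1)) * A = 1"
    using A0 by (simp add: fps_compose_mult_distrib fps_compose_add_distrib del: fps_inverse_mult)
  moreover have "(1 - u) * A = 1" using A by (subst mult.commute)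
  ultimately have L: "inverse (1 + fps_X) oo (A - 1) = 1 - u" by (rule uniq)
  have A': "fps_deriv A * (1 - u) = A * fps_deriv u"
    using arg_cong[OF A, of fps_deriv] by (simp add: algebra_simps)
  show "fps_deriv (fps_ln 1 oo (A - 1)) = fps_deriv (?H oo u)"
    using u0 A0 by (simp add: fps_compose_deriv fps_ln_deriv L H' mult.commute[of "1 - u"] A')
  show "(fps_ln 1 oo (A - 1)) $ 0 = (?H oo u) $ 0" by simp
qed

text \<open>With \<open>A = 1/(1 - 2u)\<close>, both sides are \<open>(1 - 2u)^(-1/2)\<close>, whose
  coefficients are \<open>(2k-1)!!/k!\<close>. Both solve \<open>y' * (1 - 2u) = y * u'\<close> with
  constant term 1.\<close>

lemma fps_binomial_half_compose:
  fixes u :: "'a::field_char_0 fps"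
  assumes u0: "u $ 0 = 0" and A: "A * (1 - fps_const 2 * u) = 1"
  shows "fps_binomial (1/2) oo (A - 1) = Abs_fps (\<lambda>k. of_nat (\<Prod>i<k. 2 * i + 1) / fact k) oo u"
    (is "?S = ?H oo u")
proof -
  let ?v = "1 - fps_const 2 * u"
  have "A $ 0 * ?v $ 0 = 1" using arg_cong[OF A, of "\<lambda>f. f $ 0"] by simp
  then have A0: "(A - 1) $ 0 = 0" using u0 by simp
  have nz: "?v \<noteq> 0" "A \<noteq> 0" using A by auto
  have H: "fps_deriv ?H * (1 - fps_const 2 * fps_X) = ?H"
  proof (rule fps_ext)
    fix n
    have d: "fps_deriv ?H $ k = (2 * of_nat k + 1) * ?H $ k" for k
      by (simp add: add.commute del: of_nat_Suc) (simp add: algebra_simps)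
    have X: "fps_deriv ?H * (1 - fps_const 2 * fps_X) = fps_deriv ?H - fps_const 2 * (fps_X * fps_deriv ?H)"
      by (simp add: algebra_simps)
    show "(fps_deriv ?H * (1 - fps_const 2 * fps_X)) $ n = ?H $ n"
    proof (cases n)
      case 0
      then show ?thesis unfolding X by simp
    next
      case (Suc m)
      have "(fps_X * fps_deriv ?H) $ n = of_nat n * ?H $ n" using Suc by simp
      moreover have "(2 * x + 1) * y - 2 * (x * y) = y" for x y :: 'a
        by (simp add: algebra_simps)
      ultimately show ?thesis unfolding X fps_sub_nth d fps_mult_left_const_nth by metis
    qed
  qed
  have H': "(fps_deriv ?H oo u) * ?v = ?H oo u"
    using arg_cong[OF H, of "\<lambda>f. f oo u"] u0
    by (simp add: fps_compose_mult_distrib fps_compose_sub_distrib)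
  have "fps_deriv (fps_binomial (1/2)) * (1 + fps_X) = fps_const (1/2 :: 'a) * fps_binomial (1/2)"
    unfolding fps_binomial_deriv by (simp add: fps_divide_unit mult.assoc inverse_mult_eq_1)
  from arg_cong[OF this, of "\<lambda>f. f oo (A - 1)"]
  have S': "(fps_deriv (fps_binomial (1/2)) oo (A - 1)) * A = fps_const (1/2) * ?S"
    using A0 by (simp add: fps_compose_mult_distrib fps_compose_add_distrib)
  have A': "fps_deriv A * ?v = fps_const 2 * A * fps_deriv u"
    using arg_cong[OF A, of fps_deriv] by (simp add: algebra_simps)
  let ?dS = "fps_deriv ?S" and ?dH = "fps_deriv (?H oo u)"
  have dH: "?dH * ?v = (?H oo u) * fps_deriv u"
    using u0 H' by (simp add: fps_compose_deriv mult_ac)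
  have "(?dS * ?v) = (fps_deriv (fps_binomial (1/2)) oo (A - 1)) * (fps_deriv A * ?v)"
    using A0 by (simp add: fps_compose_deriv mult_ac)
  also have "\<dots> = fps_const 2 * ((fps_deriv (fps_binomial (1/2)) oo (A - 1)) * A) * fps_deriv u"
    unfolding A' by (simp only: mult_ac)
  also have "\<dots> = ?S * fps_deriv u"
    unfolding S' by (simp add: mult.assoc[symmetric])
  finally have dS: "?dS * ?v = ?S * fps_deriv u" .
  have H0: "(?H oo u) $ 0 = 1" "?S $ 0 = 1" by simp_all
  \<comment> \<open>The quotient of two solutions of this first-order linear equation has derivative
    zero.\<close>
  define R where "R = ?S * inverse (?H oo u)"
  have inv: "inverse (?H oo u) * (?H oo u) = 1" using H0 by (simp add: inverse_mult_eq_1)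
  have RS: "R * (?H oo u) = ?S" unfolding R_def using inv by (simp add: mult.assoc)
  have "fps_deriv R * (?H oo u) * ?v + R * (?dH * ?v) = ?dS * ?v"
    unfolding RS[symmetric] by (simp add: algebra_simps)
  then have "fps_deriv R * (?H oo u) * ?v = 0"
    unfolding dS dH using RS by (simp add: mult.assoc[symmetric])
  moreover have "?H oo u \<noteq> 0" using H0 by (metis fps_zero_nth zero_neq_one)
  ultimately have "fps_deriv R = 0" using nz by (simp only: mult_eq_0_iff) simp
  then have "R = fps_const (R $ 0)" by (simp add: fps_deriv_eq_0_iff)
  moreover have "R $ 0 = 1" unfolding R_def using H0 by simp
  ultimately show ?thesis using RS by simp
qed

subsection \<open>Arrangements of linear subspaces\<close>

declare mobius.simps [simp del]

text \<open>As \<open>e\<close> lies below every member, the interval from \<open>e\<close> to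
  \<open>X\<close> is all of \<open>F\<close> below \<open>X\<close>. So the prescribed lower sums
  are the recursion of \<open>mobius F e\<close>, and induction on the number of members strictly
  below \<open>X\<close> applies.\<close>

lemma mobius_eqI:
  fixes g :: "'a set \<Rightarrow> 'b::ring_1"
  assumes "finite F" and bot: "\<And>X. X \<in> F \<Longrightarrow> e \<subseteq> X"
    and g: "\<And>X. X \<in> F \<Longrightarrow> (\<Sum>Y\<in>{Y\<in>F. Y \<subseteq> X}. g Y) = (if X = e then 1 else 0)"
    and "X \<in> F"
  shows "of_int (mobius F e X) = g X"
  using \<open>X \<in> F\<close>
proof (induction "card {W\<in>F. W \<subset> X}" arbitrary: X rule: less_induct)
  case (less X)
  have IH: "of_int (mobius F e Y) = g Y" if "Y \<in> F" "Y \<subset> X" for Y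
    using that less.prems \<open>finite F\<close> by (intro less.hyps psubset_card_mono) auto
  have "{Y\<in>F. Y \<subseteq> X} = insert X {Y\<in>F. Y \<subset> X}" using less.prems by auto
  then have split: "(\<Sum>Y\<in>{Y\<in>F. Y \<subseteq> X}. g Y) = g X + (\<Sum>Y\<in>{Y\<in>F. Y \<subset> X}. g Y)"
    using \<open>finite F\<close> by simp
  show ?case
  proof (cases "X = e")
    case True
    then have "{Y\<in>F. Y \<subset> X} = {}" using bot by blast
    then have "g X = 1" using split[unfolded g[OF less.prems]] True by (simp only: sum.empty) simp
    then show ?thesis using True by (simp add: mobius.simps)
  next
    case False
    have "{Z\<in>F. e \<subseteq> Z \<and> Z \<subset> X} = {Y\<in>F. Y \<subset> X}" using bot by auto
    then have "of_int (mobius F e X) = - (\<Sum>Y\<in>{Y\<in>F. Y \<subset> X}. of_int (mobius F e Y) :: 'b)"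
      using False bot[OF less.prems] \<open>finite F\<close> by (subst mobius.simps) auto
    also have "\<dots> = - (\<Sum>Y\<in>{Y\<in>F. Y \<subset> X}. g Y)"
      using IH by simp
    also have "\<dots> = g X"
      using split g[OF less.prems] False by (simp add: neg_eq_iff_add_eq_0 add.commute)
    finally show ?thesis .
  qed
qed

section \<open>Flats, least flats and generic points\<close>

interpretation fs: vector_space fscale
  by unfold_locales (auto simp: fscale_def algebra_simps fun_eq_iff)

definition flat_hull :: "nat \<Rightarrow> (nat \<Rightarrow> real) set set \<Rightarrow> (nat \<Rightarrow> real) set \<Rightarrow> (nat \<Rightarrow> real) set" where
  "flat_hull n A Y = ambient n \<inter> \<Inter>{H \<in> A. Y \<subseteq> H}"

lemma flat_hull_in_flats: "flat_hull n A Y \<in> flats n A"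
  unfolding flat_hull_def flats_def by blast

lemma subset_flat_hull: "Y \<subseteq> ambient n \<Longrightarrow> Y \<subseteq> flat_hull n A Y"
  unfolding flat_hull_def by blast

lemma flat_hull_subset: "X \<in> flats n A \<Longrightarrow> Y \<subseteq> X \<Longrightarrow> flat_hull n A Y \<subseteq> X"
  unfolding flat_hull_def flats_def by blast

lemma flat_subset_ambient: "X \<in> flats n A \<Longrightarrow> X \<subseteq> ambient n"
  unfolding flats_def by blast

lemma flats_mono: "A \<subseteq> B \<Longrightarrow> flats n A \<subseteq> flats n B"
  unfolding flats_def by blast

text \<open>A member of \<open>B\<close> is also one of \<open>A\<close>, so it contains the
  \<open>A\<close>-hull of \<open>Y\<close> as soon as it contains \<open>Y\<close>. This makes type
  D hulls computable from type B hulls.\<close>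

lemma flat_hull_flat_hull:
  assumes "B \<subseteq> A" "Y \<subseteq> ambient n"
  shows "flat_hull n B (flat_hull n A Y) = flat_hull n B Y"
proof -
  have "flat_hull n A Y \<subseteq> H \<longleftrightarrow> Y \<subseteq> H" if "H \<in> B" for H
    using that assms unfolding flat_hull_def by blast
  then show ?thesis unfolding flat_hull_def[of n B] by blast
qed

lemma finite_flats: "finite A \<Longrightarrow> finite (flats n A)"
proof -
  have "flats n A = (\<lambda>S. ambient n \<inter> \<Inter>S) ` Pow A"
    unfolding flats_def by blast
  then show "finite A \<Longrightarrow> finite (flats n A)" by simp
qed

lemma subspace_ambient: "fs.subspace (ambient n)"
  by (auto simp: fs.subspace_def ambient_def fscale_def)

lemma subspace_flat:
  assumes "\<And>H. H \<in> A \<Longrightarrow> fs.subspace H" "X \<in> flats n A"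
  shows "fs.subspace X"
  using assms subspace_ambient unfolding flats_def
  by (auto intro!: fs.subspace_inter fs.subspace_Inter)

text \<open>A flat is not covered by the finitely many proper intersections with members of \<open>A\<close>: a point
  of \<open>X\<close> on the fewest members of \<open>A\<close> can only lie on those containing \<open>X\<close>, since otherwise moving
  it slightly along some \<open>u \<in> X\<close> leaves one of them without entering another.\<close>

lemma flat_eq_flat_hull_point:
  assumes "finite A" and sub: "\<And>H. H \<in> A \<Longrightarrow> fs.subspace H" and X: "X \<in> flats n A"
  obtains v where "v \<in> X" "flat_hull n A {v} = X"
proof -
  define m where "m v = card {H\<in>A. v \<in> H}" for v
  note subX = subspace_flat[OF sub X]
  have "0 \<in> X" using subX by (simp add: fs.subspace_0)
  then obtain v where v: "v \<in> X" and min: "\<And>u. u \<in> X \<Longrightarrow> m v \<le> m u"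
    using arg_min_natI[of "\<lambda>u. u \<in> X" 0 m] arg_min_nat_le[of "\<lambda>u. u \<in> X" _ m] by blast
  have "u \<in> H" if u: "u \<in> X" and H: "H \<in> A" "v \<in> H" for u H
  proof (rule ccontr)
    assume uH: "u \<notin> H"
    define bad where "bad = (\<Union>K\<in>{K\<in>A. v \<notin> K}. {e. v + fscale e u \<in> K})"
    \<comment> \<open>The line through \<open>v\<close> in direction \<open>u\<close> meets a
      subspace \<open>K\<close> missing \<open>v\<close> at most once: two points would put a
      multiple of \<open>u\<close> in \<open>K\<close>, and then \<open>v\<close> itself.\<close>
    have one: "e = e'" if K: "K \<in> A" "v \<notin> K" and e: "v + fscale e u \<in> K" "v + fscale e' u \<in> K" for K e e'
    proof (rule ccontr)
      assume ne: "e \<noteq> e'"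
      have "(v + fscale e u) - (v + fscale e' u) \<in> K"
        using fs.subspace_diff[OF sub[OF K(1)]] e by blast
      then have "fscale (e - e') u \<in> K" by (simp add: fs.scale_left_diff_distrib)
      then have "fscale (e / (e - e')) (fscale (e - e') u) \<in> K"
        using fs.subspace_scale[OF sub[OF K(1)]] by blast
      then have "fscale e u \<in> K" using ne by simp
      then have "(v + fscale e u) - fscale e u \<in> K"
        using fs.subspace_diff[OF sub[OF K(1)]] e by blast
      then show False using K by simp
    qed
    have "finite {e. v + fscale e u \<in> K}" if "K \<in> A" "v \<notin> K" for K
    proof (cases "{e. v + fscale e u \<in> K} = {}")
      case False
      then obtain e where "v + fscale e u \<in> K" by blast
      then have "{e. v + fscale e u \<in> K} \<subseteq> {e}" using one[OF that] by blast
      then show ?thesis by (rule finite_subset) simp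
    qed simp
    \<comment> \<open>The value 0 is excluded too, so that the move really leaves
      \<open>H\<close>.\<close>
    then have "finite (insert 0 bad)" unfolding bad_def using \<open>finite A\<close> by auto
    then obtain e where e: "e \<noteq> 0" "e \<notin> bad"
      using ex_new_if_finite[OF infinite_UNIV_char_0] by blast
    let ?v = "v + fscale e u"
    have "?v \<in> X" using subX v u by (simp add: fs.subspace_add fs.subspace_scale)
    moreover have "{K\<in>A. ?v \<in> K} \<subset> {K\<in>A. v \<in> K}"
    proof -
      have "?v \<notin> H"
      proof
        assume "?v \<in> H"
        then have "?v - v \<in> H" using fs.subspace_diff[OF sub[OF H(1)]] H by blast
        then have "fscale e u \<in> H" by simp
        from fs.subspace_scale[OF sub[OF H(1)] this, of "1 / e"] show False using e uH by simp
      qed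
      then show ?thesis using H e unfolding bad_def by blast
    qed
    then have "m ?v < m v" unfolding m_def using \<open>finite A\<close> by (intro psubset_card_mono) auto
    ultimately show False using min by force
  qed
  then have "X \<subseteq> flat_hull n A {v}"
    using flat_subset_ambient[OF X] unfolding flat_hull_def by blast
  then show thesis using that[OF v] flat_hull_subset[OF X, of "{v}"] v by blast
qed

text \<open>Every point has exactly one least flat, it lies in that flat, and for a point of
  \<open>X\<close> that flat is contained in \<open>X\<close>.\<close>

lemma card_flat_Int:
  assumes "finite A" "finite S" "S \<subseteq> ambient n" "X \<in> flats n A"
  shows "card (X \<inter> S) = (\<Sum>Y\<in>{Y\<in>flats n A. Y \<subseteq> X}. card {v\<in>S. flat_hull n A {v} = Y})"
proof -
  have "X \<inter> S = (\<Union>Y\<in>{Y\<in>flats n A. Y \<subseteq> X}. {v\<in>S. flat_hull n A {v} = Y})"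
  proof (intro equalityI subsetI)
    fix v assume "v \<in> X \<inter> S"
    then show "v \<in> (\<Union>Y\<in>{Y\<in>flats n A. Y \<subseteq> X}. {v\<in>S. flat_hull n A {v} = Y})"
      using flat_hull_in_flats[of n A "{v}"] flat_hull_subset[OF assms(4), of "{v}"] by simp
  next
    fix v assume v: "v \<in> (\<Union>Y\<in>{Y\<in>flats n A. Y \<subseteq> X}. {v\<in>S. flat_hull n A {v} = Y})"
    then have "v \<in> flat_hull n A {v}" using subset_flat_hull[of "{v}" n A] assms(3) by auto
    then show "v \<in> X \<inter> S" using v by auto
  qed
  then show ?thesis
    using assms finite_flats[of A n] by (simp only:) (rule card_UN_disjoint; auto)
qed

text \<open>Both sides of \<open>card_flat_Int\<close> are polynomials in the number \<open>t q\<close> of admissible coordinate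
  values; comparing the coefficients of \<open>t^d\<close>, with \<open>d\<close> the least dimension of a flat, yields the
  defining recursion of the Moebius function.\<close>

lemma mobius_eq_coeff:
  fixes S :: "nat \<Rightarrow> (nat \<Rightarrow> real) set" and t :: "nat \<Rightarrow> real" and p :: "(nat \<Rightarrow> real) set \<Rightarrow> real poly"
  assumes fin: "finite A" and S: "\<And>q. finite (S q)" "\<And>q. S q \<subseteq> ambient n" and "inj t"
    and dim: "\<And>X q. X \<in> flats n A \<Longrightarrow> real (card (X \<inter> S q)) = t q ^ vdim X"
    and p: "\<And>X q. X \<in> flats n A \<Longrightarrow> real (card {v\<in>S q. flat_hull n A {v} = X}) = poly (p X) (t q)"
    and bot: "\<And>X. X \<in> flats n A \<Longrightarrow> vdim X = d \<longleftrightarrow> X = ambient n \<inter> \<Inter>A"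
    and X: "X \<in> flats n A"
  shows "real_of_int (mobius (flats n A) (ambient n \<inter> \<Inter>A) X) = coeff (p X) d"
proof (rule mobius_eqI[OF finite_flats[OF fin] _ _ X])
  fix X assume X: "X \<in> flats n A"
  show "ambient n \<inter> \<Inter>A \<subseteq> X" using X unfolding flats_def by blast
  \<comment> \<open>The two polynomials agree at every \<open>t q\<close>, and these are infinitely
    many values because \<open>t\<close> is injective.\<close>
  have "(\<Sum>Y\<in>{Y\<in>flats n A. Y \<subseteq> X}. p Y) = monom 1 (vdim X)" (is "?P = _")
  proof (rule ccontr)
    assume "?P \<noteq> monom 1 (vdim X)"
    then have "finite {x. poly (?P - monom 1 (vdim X)) x = 0}"
      by (intro poly_roots_finite) simp
    moreover have "poly ?P (t q) = t q ^ vdim X" for q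
      using card_flat_Int[OF fin S X, of q] dim[OF X, of q]
      by (simp add: poly_sum flip: p)
    then have "range t \<subseteq> {x. poly (?P - monom 1 (vdim X)) x = 0}"
      by (auto simp: poly_monom)
    ultimately have "finite (range t)" by (rule finite_subset[rotated])
    then show False using \<open>inj t\<close> by (simp add: finite_image_iff)
  qed
  then have "(\<Sum>Y\<in>{Y\<in>flats n A. Y \<subseteq> X}. coeff (p Y) d) = coeff (monom 1 (vdim X)) d"
    by (simp flip: coeff_sum)
  then show "(\<Sum>Y\<in>{Y\<in>flats n A. Y \<subseteq> X}. coeff (p Y) d) = (if X = ambient n \<inter> \<Inter>A then 1 else 0)"
    using bot[OF X] by simp
qed

subsection \<open>Flats of the braid arrangement and of type B\<close>

text \<open>Braid (\<open>b = False\<close>) and type B (\<open>b = True\<close>) arrangements are treated together. Writing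
  \<open>x = gsgn b x * gabs b x\<close>, i.e. \<open>x = 1 * x\<close> resp. \<open>x = sgn x * \<bar>x\<bar>\<close>, the least flat containing \<open>v\<close>
  consists of the points \<open>gsgn b (v i) * f (gabs b (v i))\<close> for arbitrary \<open>f\<close>; only the values of \<open>f\<close>
  on \<open>reps b n v\<close> matter.\<close>

definition arrAB :: "bool \<Rightarrow> nat \<Rightarrow> (nat \<Rightarrow> real) set set" where
  "arrAB b n = (if b then arrB n else arrA n)"

definition gsgn :: "bool \<Rightarrow> real \<Rightarrow> real" where
  "gsgn b x = (if b then sgn x else 1)"

definition gabs :: "bool \<Rightarrow> real \<Rightarrow> real" where
  "gabs b x = (if b then \<bar>x\<bar> else x)"

text \<open>The number of values with nonzero \<open>gsgn\<close> sharing one \<open>gabs\<close>: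
  \<open>x\<close> and \<open>- x\<close> in type B, \<open>x\<close> alone for the braid
  arrangement.\<close>

definition num_signs :: "bool \<Rightarrow> nat" where
  "num_signs b = (if b then 2 else 1)"

definition param :: "bool \<Rightarrow> nat \<Rightarrow> (nat \<Rightarrow> real) \<Rightarrow> (real \<Rightarrow> real) \<Rightarrow> nat \<Rightarrow> real" where
  "param b n v f = (\<lambda>i. if i < n then gsgn b (v i) * f (gabs b (v i)) else 0)"

text \<open>One element per free parameter of the least flat of \<open>v\<close>. Coordinates equal
  to 0 are dropped in type B only; for the braid arrangement 0 is an ordinary value.\<close>

definition reps :: "bool \<Rightarrow> nat \<Rightarrow> (nat \<Rightarrow> real) \<Rightarrow> real set" where
  "reps b n v = gabs b ` {x \<in> v ` {..<n}. gsgn b x \<noteq> 0}"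

definition param_flat :: "bool \<Rightarrow> nat \<Rightarrow> (nat \<Rightarrow> real) \<Rightarrow> (nat \<Rightarrow> real) set" where
  "param_flat b n v = range (param b n v)"

definition vals :: "bool \<Rightarrow> nat \<Rightarrow> real set" where
  "vals b q = of_int ` (if b then {- int q..int q} else {1..int q})"

text \<open>The admissible set may depend on the coordinate, so that points with a prescribed zero
  coordinate are also counted by a box.\<close>

definition box :: "nat \<Rightarrow> (nat \<Rightarrow> real set) \<Rightarrow> (nat \<Rightarrow> real) set" where
  "box n Z = {u \<in> ambient n. \<forall>i<n. u i \<in> Z i}"

definition grid :: "bool \<Rightarrow> nat \<Rightarrow> nat \<Rightarrow> (nat \<Rightarrow> real) set" where
  "grid b n q = box n (\<lambda>_. vals b q)"

section \<open>Signs, coordinate values and grid points\<close>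

lemma gsgn_times_gabs: "gsgn b x * gabs b x = x"
  by (simp add: gsgn_def gabs_def sgn_mult_abs)

lemma gsgn_square: "gsgn b x \<noteq> 0 \<Longrightarrow> gsgn b x * gsgn b x = 1"
  by (simp add: gsgn_def sgn_if split: if_splits)

lemma gsgn_mult: "gsgn b (gsgn b x * y) = gsgn b x * gsgn b y"
  by (simp add: gsgn_def sgn_mult)

lemma gabs_mult: "gsgn b x \<noteq> 0 \<Longrightarrow> gabs b (gsgn b x * y) = gabs b y"
  by (simp add: gsgn_def gabs_def abs_mult sgn_if split: if_splits)

lemma gsgn_eq_0: "gsgn b x = 0 \<Longrightarrow> x = 0"
  by (metis gsgn_times_gabs mult_zero_left)

lemma gsgn_0: "gsgn b x = 0 \<Longrightarrow> gsgn b 0 = 0"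
  by (simp add: gsgn_def split: if_splits)

lemma finite_vals: "finite (vals b q)"
  by (simp add: vals_def)

lemma card_vals: "card (vals b q) = num_signs b * q + (if b then 1 else 0)"
  unfolding vals_def by (subst card_image) (auto simp: num_signs_def inj_on_def)

lemma zero_in_vals: "0 \<in> vals True q"
  unfolding vals_def by (auto intro!: image_eqI[of _ _ 0])

lemma uminus_in_vals: "x \<in> vals True q \<Longrightarrow> - x \<in> vals True q"
  unfolding vals_def by (auto intro!: image_eqI[of _ _ "- _"] simp flip: of_int_minus)

lemma gsgn_mult_in_vals: "y \<in> vals b q \<Longrightarrow> gsgn b x * y \<in> vals b q"
  using zero_in_vals[of q] uminus_in_vals[of y q] by (cases b) (auto simp: gsgn_def sgn_if)

lemma card_nonzero_vals: "card {x \<in> vals b q. gsgn b x \<noteq> 0} = num_signs b * q"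
proof (cases b)
  case True
  have "{x \<in> vals b q. gsgn b x \<noteq> 0} = vals True q - {0}"
    using True by (auto simp: gsgn_def sgn_0_0)
  then show ?thesis
    using True zero_in_vals card_vals[of True q] finite_vals by (simp add: num_signs_def)
next
  case False
  then show ?thesis using card_vals[of b q] by (simp add: gsgn_def)
qed

lemma card_vals_fibre:
  assumes "x \<in> vals b q" "gsgn b x \<noteq> 0"
  shows "card {y \<in> {y \<in> vals b q. gsgn b y \<noteq> 0}. gabs b y = gabs b x} = num_signs b"
proof (cases b)
  case True
  have "{y \<in> {y \<in> vals b q. gsgn b y \<noteq> 0}. gabs b y = gabs b x} = {x, - x}"
    using True assms uminus_in_vals[of x q] by (auto simp: gsgn_def gabs_def)
  moreover have "x \<noteq> - x" using True assms by (auto simp: gsgn_def)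
  ultimately show ?thesis using True by (simp add: num_signs_def)
next
  case False
  then have "{y \<in> {y \<in> vals b q. gsgn b y \<noteq> 0}. gabs b y = gabs b x} = {x}"
    using assms by (auto simp: gsgn_def gabs_def)
  then show ?thesis using False by (simp add: num_signs_def)
qed

lemma card_box: "card (box n Z) = (\<Prod>i<n. card (Z i))"
  and finite_box: "(\<And>i. i < n \<Longrightarrow> finite (Z i)) \<Longrightarrow> finite (box n Z)"
proof -
  \<comment> \<open>Functions in \<open>PiE\<close> are \<open>undefined\<close> outside their
    domain, vectors of \<open>ambient n\<close> are 0 there; \<open>?r\<close> translates between
    the two.\<close>
  let ?r = "\<lambda>f i. if i < n then f i else (0::real)"
  have "bij_betw ?r (PiE {..<n} Z) (box n Z)"
  proof (rule bij_betwI[where g = "\<lambda>u. restrict u {..<n}"])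
    show "?r \<in> (PiE {..<n} Z) \<rightarrow> box n Z"
      by (rule Pi_I) (simp add: box_def ambient_def PiE_iff)
    show "(\<lambda>u. restrict u {..<n}) \<in> box n Z \<rightarrow> PiE {..<n} Z"
      by (rule Pi_I) (simp add: box_def)
    show "restrict (?r f) {..<n} = f" if "f \<in> PiE {..<n} Z" for f
      using that by (simp add: fun_eq_iff PiE_iff extensional_def)
    show "?r (restrict u {..<n}) = u" if "u \<in> box n Z" for u
      using that by (simp add: fun_eq_iff box_def ambient_def)
  qed
  note bij = this
  show "card (box n Z) = (\<Prod>i<n. card (Z i))"
    using bij_betw_same_card[OF bij] by (simp add: card_PiE)
  show "finite (box n Z)" if "\<And>i. i < n \<Longrightarrow> finite (Z i)"
    unfolding bij_betw_finite[OF bij, symmetric] using that by (intro finite_PiE) auto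
qed

lemma grid_subset_ambient: "grid b n q \<subseteq> ambient n"
  by (auto simp: grid_def box_def)

lemma finite_grid: "finite (grid b n q)"
  unfolding grid_def by (intro finite_box finite_vals)

section \<open>Parametrised flats and their dimension\<close>

lemma finite_reps: "finite (reps b n v)"
  by (simp add: reps_def)

lemma card_reps_le: "card (reps b n v) \<le> n"
proof -
  have "card (reps b n v) \<le> card {x \<in> v ` {..<n}. gsgn b x \<noteq> 0}"
    unfolding reps_def by (intro card_image_le) simp
  also have "\<dots> \<le> card (v ` {..<n})" by (intro card_mono) auto
  also have "\<dots> \<le> n" using card_image_le[of "{..<n}" v] by simp
  finally show ?thesis .
qed

lemma in_repsI: "i < n \<Longrightarrow> gsgn b (v i) \<noteq> 0 \<Longrightarrow> gabs b (v i) \<in> reps b n v"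
  by (auto simp: reps_def)

lemma param_cong:
  assumes "\<And>r. r \<in> reps b n v \<Longrightarrow> f r = g r"
  shows "param b n v f = param b n v g"
  using assms by (auto simp: param_def fun_eq_iff dest: in_repsI)

lemma param_eqD:
  assumes "param b n v f = param b n v g" "r \<in> reps b n v"
  shows "f r = g r"
proof -
  obtain i where i: "i < n" "gsgn b (v i) \<noteq> 0" "r = gabs b (v i)"
    using assms(2) by (auto simp: reps_def)
  show ?thesis using fun_cong[OF assms(1), of i] i by (simp add: param_def)
qed

lemma param_flat_subset_ambient: "param_flat b n v \<subseteq> ambient n"
  by (auto simp: param_flat_def param_def ambient_def)

lemma in_param_flat_self: "v \<in> ambient n \<Longrightarrow> v \<in> param_flat b n v"
  unfolding param_flat_def
  by (intro range_eqI[of _ _ "\<lambda>x. x"]) (auto simp: param_def gsgn_times_gabs ambient_def fun_eq_iff)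

text \<open>The values of \<open>f\<close> on \<open>reps b n v\<close> are free coordinates on the
  flat. Integrality passes both ways because \<open>vals b q\<close> is closed under multiplication
  by any \<open>gsgn\<close>, and \<open>f r\<close> is recovered as
  \<open>gsgn b (v i) * u i\<close>.\<close>

lemma bij_betw_param:
  "bij_betw (param b n v) (reps b n v \<rightarrow>\<^sub>E vals b q) (param_flat b n v \<inter> grid b n q)"
proof (rule bij_betw_imageI)
  show "inj_on (param b n v) (reps b n v \<rightarrow>\<^sub>E vals b q)"
    by (rule inj_onI) (metis PiE_ext param_eqD)
  show "param b n v ` (reps b n v \<rightarrow>\<^sub>E vals b q) = param_flat b n v \<inter> grid b n q"
  proof (intro equalityI subsetI)
    fix u assume "u \<in> param b n v ` (reps b n v \<rightarrow>\<^sub>E vals b q)"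
    then obtain f where f: "f \<in> reps b n v \<rightarrow>\<^sub>E vals b q" "u = param b n v f" by blast
    have "u i \<in> vals b q" if "i < n" for i
    proof (cases "gsgn b (v i) = 0")
      case True
      then have b by (simp add: gsgn_def split: if_splits)
      then show ?thesis using True that zero_in_vals by (simp add: f param_def)
    next
      case False
      then have "f (gabs b (v i)) \<in> vals b q" using f(1) in_repsI[of i n b v] that False by blast
      then show ?thesis using that by (simp add: f(2) param_def gsgn_mult_in_vals)
    qed
    then show "u \<in> param_flat b n v \<inter> grid b n q"
      using param_flat_subset_ambient[of b n v] by (auto simp: f(2) param_flat_def grid_def box_def)
  next
    fix u assume u: "u \<in> param_flat b n v \<inter> grid b n q"
    then obtain f where f: "u = param b n v f" by (auto simp: param_flat_def)
    have "f r \<in> vals b q" if r: "r \<in> reps b n v" for r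
    proof -
      obtain i where i: "i < n" "gsgn b (v i) \<noteq> 0" "r = gabs b (v i)"
        using r by (auto simp: reps_def)
      have "u i = gsgn b (v i) * f r" using i by (simp add: f param_def)
      then have "f r = gsgn b (v i) * u i" using gsgn_square[OF i(2)] by (simp flip: mult.assoc)
      then show ?thesis using u i by (simp add: grid_def box_def gsgn_mult_in_vals)
    qed
    then have "restrict f (reps b n v) \<in> reps b n v \<rightarrow>\<^sub>E vals b q" by simp
    moreover have "u = param b n v (restrict f (reps b n v))"
      unfolding f by (rule param_cong) simp
    ultimately show "u \<in> param b n v ` (reps b n v \<rightarrow>\<^sub>E vals b q)" by (intro image_eqI)
  qed
qed

lemma card_param_flat_Int_grid: "card (param_flat b n v \<inter> grid b n q) = card (vals b q) ^ card (reps b n v)"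
  using bij_betw_same_card[OF bij_betw_param, of b n v q] finite_reps by (simp add: card_PiE)

lemma sum_fun_apply: "(\<Sum>x\<in>A. g x) i = (\<Sum>x\<in>A. g x i)"
  for g :: "'a \<Rightarrow> 'b \<Rightarrow> 'c::comm_monoid_add"
  by (induction A rule: infinite_finite_induct) auto

text \<open>The images \<open>e r\<close> of the indicator functions of single representatives form
  a basis.\<close>

lemma vdim_param_flat: "vdim (param_flat b n v) = card (reps b n v)"
proof -
  define e where "e r = param b n v (\<lambda>x. if x = r then 1 else 0)" for r
  let ?B = "e ` reps b n v"
  have inj: "inj_on e (reps b n v)"
  proof (rule inj_onI)
    fix r s assume "r \<in> reps b n v" "s \<in> reps b n v" "e r = e s"
    from param_eqD[OF this(3)[unfolded e_def] this(1)] show "r = s" by (simp split: if_splits)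
  qed
  have sum_e: "param b n v f = (\<Sum>r\<in>reps b n v. fscale (f r) (e r))" for f
  proof
    fix i
    show "param b n v f i = (\<Sum>r\<in>reps b n v. fscale (f r) (e r)) i"
    proof (cases "i < n \<and> gsgn b (v i) \<noteq> 0")
      case True
      have "(\<Sum>r\<in>reps b n v. fscale (f r) (e r)) i
          = (\<Sum>r\<in>reps b n v. if r = gabs b (v i) then gsgn b (v i) * f r else 0)"
        unfolding sum_fun_apply using True
        by (intro sum.cong) (auto simp: fscale_def e_def param_def)
      then show ?thesis using True finite_reps in_repsI[of i n b v] by (simp add: param_def)
    next
      case False
      then show ?thesis by (auto simp: sum_fun_apply fscale_def e_def param_def)
    qed
  qed
  have "fs.dim (param_flat b n v) = card (reps b n v)"
  proof (rule fs.dim_unique)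
    show "?B \<subseteq> param_flat b n v" by (auto simp: e_def param_flat_def)
    show "param_flat b n v \<subseteq> fs.span ?B"
      unfolding param_flat_def sum_e
      by clarify (rule fs.span_sum, rule fs.span_scale, rule fs.span_base, simp)
    show "fs.independent ?B"
    proof (rule fs.independent_if_scalars_zero)
      show "finite ?B" using finite_reps by simp
      fix g x assume g: "(\<Sum>x\<in>?B. fscale (g x) x) = 0" and x: "x \<in> ?B"
      have "param b n v (\<lambda>r. g (e r)) = 0"
        using g by (simp add: sum_e sum.reindex[OF inj] comp_def)
      also have "0 = param b n v (\<lambda>_. 0)" by (auto simp: param_def fun_eq_iff)
      finally show "g x = 0" using x by (auto dest: param_eqD)
    qed
    show "card ?B = card (reps b n v)" using inj by (rule card_image)
  qed
  then show ?thesis by (simp add: vdim_def)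
qed

text \<open>Passing to a point of the flat deletes the representatives whose parameter has
  \<open>gsgn\<close> zero and merges those whose parameters have the same
  \<open>gabs\<close>.\<close>

lemma reps_param:
  "reps b n (param b n v f) = (\<lambda>r. gabs b (f r)) ` {r \<in> reps b n v. gsgn b (f r) \<noteq> 0}"
proof (intro equalityI subsetI)
  fix x assume "x \<in> reps b n (param b n v f)"
  then obtain i where i: "i < n" "x = gabs b (param b n v f i)" "gsgn b (param b n v f i) \<noteq> 0"
    by (auto simp: reps_def)
  then have c: "gsgn b (v i) \<noteq> 0" "gsgn b (f (gabs b (v i))) \<noteq> 0"
    by (auto simp: param_def gsgn_mult)
  then have "x = gabs b (f (gabs b (v i)))" using i by (simp add: param_def gabs_mult)
  then show "x \<in> (\<lambda>r. gabs b (f r)) ` {r \<in> reps b n v. gsgn b (f r) \<noteq> 0}"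
    using c in_repsI[of i n b v] i(1) by (intro image_eqI[of _ _ "gabs b (v i)"]) simp_all
next
  fix x assume "x \<in> (\<lambda>r. gabs b (f r)) ` {r \<in> reps b n v. gsgn b (f r) \<noteq> 0}"
  then obtain i where i: "i < n" "gsgn b (v i) \<noteq> 0" "gsgn b (f (gabs b (v i))) \<noteq> 0" "x = gabs b (f (gabs b (v i)))"
    by (auto simp: reps_def)
  then have "x = gabs b (param b n v f i)" "gsgn b (param b n v f i) \<noteq> 0"
    by (simp_all add: param_def gabs_mult gsgn_mult)
  then show "x \<in> reps b n (param b n v f)" using in_repsI[of i n b "param b n v f"] i(1) by simp
qed

lemma param_flat_mono:
  assumes "u \<in> param_flat b n v"
  shows "param_flat b n u \<subseteq> param_flat b n v"
proof
  fix w assume "w \<in> param_flat b n u"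
  then obtain g where g: "w = param b n u g" by (auto simp: param_flat_def)
  obtain f where f: "u = param b n v f" using assms by (auto simp: param_flat_def)
  \<comment> \<open>Parametrisations compose: \<open>gsgn\<close> is multiplicative here, and
    \<open>gabs\<close> ignores the outer sign.\<close>
  have "w = param b n v (\<lambda>r. gsgn b (f r) * g (gabs b (f r)))"
  proof
    fix i
    show "w i = param b n v (\<lambda>r. gsgn b (f r) * g (gabs b (f r))) i"
      by (cases "gsgn b (v i) = 0") (auto simp: g f param_def gsgn_mult gabs_mult dest: gsgn_0)
  qed
  then show "w \<in> param_flat b n v" by (simp add: param_flat_def)
qed

text \<open>A point spans a smaller flat exactly when representatives are deleted or merged. One
  direction compares dimensions through \<open>reps_param\<close>; the other inverts
  \<open>f\<close> to show that \<open>v\<close> lies in the flat of the new point.\<close>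

lemma param_flat_param_eq_iff:
  assumes v: "v \<in> ambient n"
  shows "param_flat b n (param b n v f) = param_flat b n v \<longleftrightarrow>
     inj_on (\<lambda>r. gabs b (f r)) (reps b n v) \<and> (\<forall>r\<in>reps b n v. gsgn b (f r) \<noteq> 0)"
    (is "_ \<longleftrightarrow> inj_on ?h ?R \<and> ?nz")
proof
  let ?Z = "{r \<in> ?R. gsgn b (f r) \<noteq> 0}"
  assume "param_flat b n (param b n v f) = param_flat b n v"
  then have c: "card (?h ` ?Z) = card ?R" by (metis vdim_param_flat reps_param)
  have "card (?h ` ?Z) \<le> card ?Z" using finite_reps by (intro card_image_le) simp
  moreover have "card ?Z \<le> card ?R" using finite_reps by (intro card_mono) auto
  ultimately have Z: "?Z = ?R" using c finite_reps by (intro card_subset_eq) auto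
  then have "inj_on ?h ?R" using c[unfolded Z] finite_reps by (intro eq_card_imp_inj_on)
  then show "inj_on ?h ?R \<and> ?nz" using Z by blast
next
  assume *: "inj_on ?h ?R \<and> ?nz"
  let ?u = "param b n v f"
  \<comment> \<open>The inverse parameter sends \<open>gabs b (f r)\<close> back to
    \<open>r\<close>; the sign \<open>gsgn b (f r)\<close> cancels the one already present in the
    coordinate.\<close>
  define g where "g y = (let r = inv_into ?R ?h y in gsgn b (f r) * r)" for y
  have "v = param b n ?u g"
  proof
    fix i
    show "v i = param b n ?u g i"
    proof (cases "i < n \<and> gsgn b (v i) \<noteq> 0")
      case True
      define r where "r = gabs b (v i)"
      have r: "r \<in> ?R" using True in_repsI by (simp add: r_def)
      have u: "?u i = gsgn b (v i) * f r" using True by (simp add: param_def r_def)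
      have "g (gabs b (f r)) = gsgn b (f r) * r"
        using * r inv_into_f_f[of ?h ?R r] by (simp add: g_def)
      then have "param b n ?u g i = gsgn b (v i) * (gsgn b (f r) * gsgn b (f r)) * r"
        using True unfolding param_def[of b n ?u] u by (simp add: gsgn_mult gabs_mult)
      also have "\<dots> = v i" using * r by (simp add: gsgn_square r_def gsgn_times_gabs)
      finally show ?thesis by simp
    next
      case False
      show ?thesis
      proof (cases "i < n")
        case True
        then have "gsgn b (v i) = 0" using False by simp
        then show ?thesis using gsgn_eq_0[of b "v i"] by (simp add: param_def gsgn_def split: if_splits)
      next
        case False
        then show ?thesis using v by (simp add: param_def ambient_def)
      qed
    qed
  qed
  then have "v \<in> param_flat b n ?u" by (auto simp: param_flat_def)
  then show "param_flat b n ?u = param_flat b n v"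
    using param_flat_mono[of v b n ?u] param_flat_mono[of ?u b n v] by (auto simp: param_flat_def)
qed

text \<open>\<open>U\<close> consists of \<open>m\<close> classes of size \<open>c\<close>, and the
  values of \<open>f\<close> must come from different classes. Adding a point to a
  \<open>k\<close>-element domain leaves \<open>c * (m - k)\<close> choices, because
  \<open>k\<close> classes are taken.\<close>

lemma card_funcset_inj_on_classes:
  fixes h :: "'b \<Rightarrow> 'c"
  assumes "finite P" "finite U" "card U = c * m" "\<And>x. x \<in> U \<Longrightarrow> card {y \<in> U. h y = h x} = c"
  shows "card {f \<in> P \<rightarrow>\<^sub>E U. inj_on (\<lambda>r. h (f r)) P} = c ^ card P * fact (card P) * (m choose card P)"
  using assms(1)
proof (induction P)
  case empty
  then show ?case by simp
next
  case (insert a P)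
  let ?I = "\<lambda>P. {f \<in> P \<rightarrow>\<^sub>E U. inj_on (\<lambda>r. h (f r)) P}"
  let ?k = "card P"
  let ?W = "\<lambda>f. {y \<in> U. h y \<notin> (\<lambda>r. h (f r)) ` P}"
  have W: "card (?W f) = c * m - c * ?k" if "f \<in> ?I P" for f
  proof -
    let ?C = "\<Union>r\<in>P. {y \<in> U. h y = h (f r)}"
    have "card ?C = (\<Sum>r\<in>P. card {y \<in> U. h y = h (f r)})"
      using that insert.hyps \<open>finite U\<close> by (intro card_UN_disjoint) (auto simp: inj_on_def)
    also have "\<dots> = (\<Sum>r\<in>P. c)" using that assms(4) by (intro sum.cong) (auto simp: PiE_iff)
    finally have "card ?C = c * ?k" by simp
    moreover have "?W f = U - ?C" by auto
    moreover have "?C \<subseteq> U" by auto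
    ultimately show ?thesis using \<open>finite U\<close> assms(3) by (metis card_Diff_subset finite_subset)
  qed
  have "bij_betw (\<lambda>(f, y). f(a := y)) (SIGMA f:?I P. ?W f) (?I (insert a P))"
  proof (rule bij_betwI[where g = "\<lambda>f. (f(a := undefined), f a)"])
    show "(\<lambda>(f, y). f(a := y)) \<in> (SIGMA f:?I P. ?W f) \<rightarrow> ?I (insert a P)"
    proof (rule Pi_I)
      fix x assume "x \<in> (SIGMA f:?I P. ?W f)"
      then obtain f y where x: "x = (f, y)" and f: "f \<in> P \<rightarrow>\<^sub>E U" "inj_on (\<lambda>r. h (f r)) P"
        "y \<in> U" "h y \<notin> (\<lambda>r. h (f r)) ` P" by auto
      have "inj_on (\<lambda>r. h ((f(a := y)) r)) (insert a P)"
      proof -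
        have eq: "r \<in> P \<Longrightarrow> (f(a := y)) r = f r" for r using insert.hyps by auto
        have "inj_on (\<lambda>r. h ((f(a := y)) r)) P" using f(2) by (simp add: inj_on_def eq del: fun_upd_apply)
        moreover have "(\<lambda>r. h ((f(a := y)) r)) ` P = (\<lambda>r. h (f r)) ` P"
          by (rule image_cong) (simp_all add: eq del: fun_upd_apply)
        ultimately show ?thesis using f(4) insert.hyps by simp
      qed
      moreover have "f(a := y) \<in> insert a P \<rightarrow>\<^sub>E U"
        using f(1,3) insert.hyps by (auto simp: PiE_iff extensional_def)
      ultimately show "(\<lambda>(f, y). f(a := y)) x \<in> ?I (insert a P)" unfolding x by (simp del: fun_upd_apply)
    qed
    show "(\<lambda>f. (f(a := undefined), f a)) \<in> ?I (insert a P) \<rightarrow> (SIGMA f:?I P. ?W f)"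
    proof (rule Pi_I)
      fix f assume f: "f \<in> ?I (insert a P)"
      have eq: "r \<in> P \<Longrightarrow> (f(a := undefined)) r = f r" for r using insert.hyps by auto
      have "inj_on (\<lambda>r. h ((f(a := undefined)) r)) P"
        using f by (simp add: inj_on_def eq del: fun_upd_apply)
      moreover have "(\<lambda>r. h ((f(a := undefined)) r)) ` P = (\<lambda>r. h (f r)) ` P"
        by (rule image_cong) (simp_all add: eq del: fun_upd_apply)
      then have "h (f a) \<notin> (\<lambda>r. h ((f(a := undefined)) r)) ` P"
        using f insert.hyps by (simp del: fun_upd_apply)
      moreover have "f(a := undefined) \<in> P \<rightarrow>\<^sub>E U"
        using f insert.hyps by (auto simp: PiE_iff extensional_def)
      ultimately show "(f(a := undefined), f a) \<in> (SIGMA f:?I P. ?W f)" using f by (simp add: PiE_iff del: fun_upd_apply)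
    qed
    show "(\<lambda>f. (f(a := undefined), f a)) ((\<lambda>(f, y). f(a := y)) x) = x" if "x \<in> (SIGMA f:?I P. ?W f)" for x
      using that insert.hyps by (auto simp: PiE_iff extensional_def fun_eq_iff)
    show "(\<lambda>(f, y). f(a := y)) (f(a := undefined), f a) = f" for f by simp
  qed
  then have "card (?I (insert a P)) = card (SIGMA f:?I P. ?W f)"
    by (rule bij_betw_same_card[symmetric])
  also have "\<dots> = (\<Sum>f\<in>?I P. card (?W f))"
    using insert.hyps \<open>finite U\<close> by (intro card_SigmaI) (auto simp: finite_PiE)
  also have "\<dots> = card (?I P) * (c * m - c * ?k)" using W by simp
  also have "\<dots> = c ^ Suc ?k * fact ?k * ((m - ?k) * (m choose ?k))"
    unfolding insert.IH diff_mult_distrib2[symmetric] by (simp add: mult_ac)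
  \<comment> \<open>Also true for \<open>?k \<ge> m\<close>, where truncated subtraction and the
    binomial coefficient make both sides 0.\<close>
  also have "(m - ?k) * (m choose ?k) = Suc ?k * (m choose Suc ?k)"
    by (metis binomial_absorb_comp binomial_absorption)
  also have "c ^ Suc ?k * fact ?k * (Suc ?k * (m choose Suc ?k))
      = c ^ card (insert a P) * fact (card (insert a P)) * (m choose card (insert a P))"
    using insert.hyps by (simp add: algebra_simps)
  finally show ?case .
qed

text \<open>The points sought are the \<open>param b n v f\<close> with \<open>f\<close>
  nonvanishing in the sense of \<open>gsgn\<close> and injective up to sign. The admissible values
  form \<open>q\<close> classes of size \<open>num_signs b\<close>.\<close>

lemma card_grid_param_flat_eq:
  assumes v: "v \<in> ambient n"
  shows "card {u \<in> grid b n q. param_flat b n u = param_flat b n v}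
     = num_signs b ^ card (reps b n v) * fact (card (reps b n v)) * (q choose card (reps b n v))"
proof -
  let ?R = "reps b n v" and ?U = "{x \<in> vals b q. gsgn b x \<noteq> 0}"
  let ?I = "{f \<in> ?R \<rightarrow>\<^sub>E ?U. inj_on (\<lambda>r. gabs b (f r)) ?R}"
  have "{u \<in> grid b n q. param_flat b n u = param_flat b n v}
      = {u \<in> param b n v ` (?R \<rightarrow>\<^sub>E vals b q). param_flat b n u = param_flat b n v}"
    using bij_betw_imp_surj_on[OF bij_betw_param, of b n v q] in_param_flat_self grid_subset_ambient[of b n q] by blast
  also have "\<dots> = param b n v ` ?I"
    using param_flat_param_eq_iff[OF v, of b] by (auto simp: PiE_iff)
  finally have "card {u \<in> grid b n q. param_flat b n u = param_flat b n v} = card (param b n v ` ?I)" by simp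
  also have "\<dots> = card ?I"
    by (intro card_image inj_on_subset[OF bij_betw_imp_inj_on[OF bij_betw_param, of b n v q]])
      (auto simp: PiE_iff extensional_def)
  also have "\<dots> = num_signs b ^ card ?R * fact (card ?R) * (q choose card ?R)"
    using card_nonzero_vals card_vals_fibre finite_reps finite_vals
    by (intro card_funcset_inj_on_classes) auto
  finally show ?thesis .
qed

section \<open>Least flats of points as parametrised flats\<close>

lemma finite_arrB: "finite (arrB n)"
proof -
  have "arrB n \<subseteq> (\<lambda>(i, j). {v \<in> ambient n. v i = v j}) ` ({..<n} \<times> {..<n})
      \<union> (\<lambda>(i, j). {v \<in> ambient n. v i = - v j}) ` ({..<n} \<times> {..<n})
      \<union> (\<lambda>i. {v \<in> ambient n. v i = 0}) ` {..<n}"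
    unfolding arrB_def by fastforce
  then show ?thesis by (rule finite_subset) simp
qed

lemma arrAB_subset_arrB: "arrAB b n \<subseteq> arrB n"
  unfolding arrAB_def arrA_def arrB_def by auto

lemma arrD_subset_arrB: "arrD n \<subseteq> arrB n"
  unfolding arrD_def arrB_def by auto

lemma finite_arrAB: "finite (arrAB b n)"
  using finite_subset[OF arrAB_subset_arrB finite_arrB] .

lemma finite_arrD: "finite (arrD n)"
  using finite_subset[OF arrD_subset_arrB finite_arrB] .

lemma subspace_arrB: "H \<in> arrB n \<Longrightarrow> fs.subspace H"
  unfolding arrB_def fs.subspace_def by (auto simp: ambient_def fscale_def)

text \<open>The hyperplanes through \<open>v\<close> record which coordinates agree, agree up to
  sign, or vanish; a point on all of them is determined by one number per representative.\<close>

lemma flat_hull_arrAB: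
  assumes v: "v \<in> ambient n"
  shows "flat_hull n (arrAB b n) {v} = param_flat b n v"
proof (intro equalityI subsetI)
  fix u assume "u \<in> param_flat b n v"
  then obtain f where f: "u = param b n v f" by (auto simp: param_flat_def)
  have "u \<in> ambient n" using f by (simp add: param_def ambient_def)
  moreover have "u \<in> H" if "H \<in> arrAB b n" "v \<in> H" for H
    using that \<open>u \<in> ambient n\<close> unfolding f
    by (cases b) (auto simp: arrAB_def arrA_def arrB_def param_def gsgn_def gabs_def sgn_minus)
  ultimately show "u \<in> flat_hull n (arrAB b n) {v}" by (simp add: flat_hull_def)
next
  fix u assume u: "u \<in> flat_hull n (arrAB b n) {v}"
  then have ua: "u \<in> ambient n" by (simp add: flat_hull_def)
  have H: "u \<in> H" if "H \<in> arrAB b n" "v \<in> H" for H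
    using u that by (simp add: flat_hull_def)
  have eq: "u i = u j" if "i < n" "j < n" "v i = v j" for i j
  proof -
    have "u i = u j" if ij: "i < j" "j < n" "v i = v j" for i j
    proof -
      have "{v \<in> ambient n. v i = v j} \<in> arrAB b n"
        using ij by (auto simp: arrAB_def arrA_def arrB_def)
      from H[OF this] show ?thesis using v ij by simp
    qed
    then show ?thesis using that by (metis linorder_neqE_nat)
  qed
  have neg: "u i = - u j" if "b" "i < n" "j < n" "i \<noteq> j" "v i = - v j" for i j
  proof -
    have *: "u i = - u j" if ij: "i < j" "j < n" "v i = - v j" for i j
    proof -
      have "{v \<in> ambient n. v i = - v j} \<in> arrAB b n"
        using ij \<open>b\<close> by (auto simp: arrAB_def arrB_def)
      from H[OF this] show ?thesis using v ij by simp
    qed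
    show ?thesis using *[of i j] *[of j i] that by (cases "i < j") auto
  qed
  have zero: "u i = 0" if "i < n" "gsgn b (v i) = 0" for i
  proof -
    have "b" using that by (simp add: gsgn_def split: if_splits)
    then have "{v \<in> ambient n. v i = 0} \<in> arrAB b n" using that by (auto simp: arrAB_def arrB_def)
    from H[OF this] show ?thesis using v that gsgn_eq_0 by simp
  qed
  have rel: "gsgn b (v i) * u i = gsgn b (v j) * u j"
    if "i < n" "j < n" "gsgn b (v i) \<noteq> 0" "gsgn b (v j) \<noteq> 0" "gabs b (v i) = gabs b (v j)" for i j
  proof (cases "v i = v j")
    case True
    then show ?thesis using eq[OF that(1,2) True] by simp
  next
    case False
    have b: "b" using False that(5) by (simp add: gabs_def split: if_splits)
    then have v: "v i = - v j" using False that(5) by (simp add: gabs_def abs_eq_iff)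
    have "u i = - u j" using neg[OF b that(1,2) _ v] False by blast
    then show ?thesis using v b by (simp add: gsgn_def sgn_minus)
  qed
  \<comment> \<open>The parameter is read off at any coordinate where \<open>gabs\<close> of
    \<open>v\<close> is \<open>r\<close>; by \<open>rel\<close> the choice does not matter.\<close>
  define f where "f r = (let j = SOME j. j < n \<and> gsgn b (v j) \<noteq> 0 \<and> gabs b (v j) = r in gsgn b (v j) * u j)" for r
  have "u = param b n v f"
  proof
    fix i
    consider "i \<ge> n" | "i < n" "gsgn b (v i) = 0" | "i < n" "gsgn b (v i) \<noteq> 0" by linarith
    then show "u i = param b n v f i"
    proof cases
      case 1
      then show ?thesis using ua by (simp add: param_def ambient_def)
    next
      case 2
      then show ?thesis using zero by (simp add: param_def)
    next
      case 3
      define j where "j = (SOME j. j < n \<and> gsgn b (v j) \<noteq> 0 \<and> gabs b (v j) = gabs b (v i))"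
      have "j < n \<and> gsgn b (v j) \<noteq> 0 \<and> gabs b (v j) = gabs b (v i)"
        unfolding j_def by (rule someI[of _ i]) (use 3 in simp)
      then have "gsgn b (v i) * u i = f (gabs b (v i))"
        using rel[of i j] 3 unfolding f_def j_def[symmetric] by simp
      then have "gsgn b (v i) * f (gabs b (v i)) = (gsgn b (v i) * gsgn b (v i)) * u i" by simp
      then show ?thesis using 3 gsgn_square[of b "v i"] by (simp add: param_def)
    qed
  qed
  then show "u \<in> param_flat b n v" by (auto simp: param_flat_def)
qed

lemma flat_arrAB_cases:
  assumes "X \<in> flats n (arrAB b n)"
  obtains v where "v \<in> ambient n" "X = param_flat b n v"
proof -
  obtain v where "v \<in> X" "flat_hull n (arrAB b n) {v} = X"
    using flat_eq_flat_hull_point[OF finite_arrAB _ assms] subspace_arrB arrAB_subset_arrB by blast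
  then show thesis using that[of v] flat_hull_arrAB flat_subset_ambient[OF assms] by blast
qed

lemma vdim_flat_le: "X \<in> flats n (arrAB b n) \<Longrightarrow> vdim X \<le> n"
  by (metis flat_arrAB_cases vdim_param_flat card_reps_le)

lemma ambient_in_flats: "ambient n \<in> flats n A"
  unfolding flats_def by (rule CollectI, rule exI[of _ "{}"]) simp

lemma card_flat_Int_grid:
  "X \<in> flats n (arrAB b n) \<Longrightarrow> card (X \<inter> grid b n q) = card (vals b q) ^ vdim X"
  by (metis flat_arrAB_cases vdim_param_flat card_param_flat_Int_grid)

text \<open>The number of grid points whose least flat is a given flat of dimension
  \<open>k\<close>.\<close>

definition injections :: "bool \<Rightarrow> nat \<Rightarrow> nat \<Rightarrow> nat" where
  "injections b k q = num_signs b ^ k * fact k * (q choose k)"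

lemma card_grid_flat_hull:
  assumes "X \<in> flats n (arrAB b n)"
  shows "card {u \<in> grid b n q. flat_hull n (arrAB b n) {u} = X} = injections b (vdim X) q"
proof -
  obtain v where v: "v \<in> ambient n" "X = param_flat b n v" using flat_arrAB_cases[OF assms] .
  have "{u \<in> grid b n q. flat_hull n (arrAB b n) {u} = X} = {u \<in> grid b n q. param_flat b n u = param_flat b n v}"
    using flat_hull_arrAB grid_subset_ambient[of b n q] v by blast
  then show ?thesis using card_grid_param_flat_eq[OF v(1)] v(2) by (simp add: injections_def vdim_param_flat)
qed

text \<open>The polynomial \<open>p_Y\<close> for \<open>dim Y = k\<close>:
  \<open>t(t-1)...(t-k+1)\<close> for the braid arrangement, \<open>(t-1)(t-3)...(t-2k+1)\<close>
  for type B.\<close>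

definition injpoly :: "bool \<Rightarrow> nat \<Rightarrow> real poly" where
  "injpoly b k = (\<Prod>i<k. [:- real (num_signs b * i + (if b then 1 else 0)), 1:])"

text \<open>At \<open>t = 2q + 1\<close> the type B factor is
  \<open>t - (2i + 1) = 2(q - i)\<close>; for the braid arrangement \<open>t = q\<close>.\<close>

lemma poly_injpoly: "poly (injpoly b k) (real (card (vals b q))) = real (injections b k q)"
proof -
  have "poly (injpoly b k) (real (card (vals b q))) = (\<Prod>i<k. real (num_signs b) * (real q - real i))"
    unfolding injpoly_def poly_prod card_vals by (intro prod.cong) (auto simp: algebra_simps)
  also have "\<dots> = real (num_signs b) ^ k * (\<Prod>i<k. real q - real i)"
    by (simp add: prod.distrib)
  also have "(\<Prod>i<k. real q - real i) = fact k * real (q choose k)"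
    by (simp add: binomial_gbinomial gbinomial_prod_rev atLeast0LessThan)
  finally show ?thesis by (simp add: injections_def)
qed

text \<open>The double factorial \<open>(2k-1)!!\<close>, respectively \<open>(k-1)!\<close>. The
  braid value 0 at \<open>k = 0\<close> is the coefficient of \<open>t\<close> in the constant 1,
  and the constant term of the logarithm.\<close>

definition abs_mobius :: "bool \<Rightarrow> nat \<Rightarrow> nat" where
  "abs_mobius b k = (if b then \<Prod>i<k. 2 * i + 1 else if k = 0 then 0 else fact (k - 1))"

lemma coeff_injpoly_True: "coeff (injpoly True k) 0 = (- 1) ^ k * real (abs_mobius True k)"
proof -
  have "coeff (injpoly True k) 0 = (\<Prod>i<k. (- 1) * real (2 * i + 1))"
    by (simp add: poly_0_coeff_0[symmetric] injpoly_def poly_prod num_signs_def algebra_simps)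
  also have "\<dots> = (- 1) ^ k * real (abs_mobius True k)"
    unfolding prod.distrib by (simp add: abs_mobius_def)
  finally show ?thesis .
qed

lemma coeff_injpoly_False: "coeff (injpoly False k) 1 = (- 1) ^ (k - 1) * real (abs_mobius False k)"
proof (cases k)
  case 0
  then show ?thesis by (simp add: injpoly_def abs_mobius_def)
next
  case (Suc m)
  have "injpoly False k = pCons 0 (\<Prod>i<m. [:- real (Suc i), 1:])"
    unfolding Suc injpoly_def by (subst prod.lessThan_Suc_shift) (simp add: num_signs_def)
  then have "coeff (injpoly False k) 1 = (\<Prod>i<m. - 1 * real (Suc i))"
    by (simp add: poly_0_coeff_0[symmetric] poly_prod)
  also have "\<dots> = (- 1) ^ m * fact m"
    unfolding prod.distrib by (simp add: fact_prod_Suc atLeast0LessThan)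
  finally show ?thesis by (simp add: abs_mobius_def Suc)
qed

lemma abs_coeff_injpoly: "\<bar>coeff (injpoly b k) (if b then 0 else 1)\<bar> = real (abs_mobius b k)"
  using coeff_injpoly_True[of k] coeff_injpoly_False[of k] by (cases b) (simp_all add: abs_mult)

lemma inj_card_vals: "inj (\<lambda>q. real (card (vals b q)))"
  by (auto simp: inj_def card_vals num_signs_def)

lemma Inter_arrAB_eq: "ambient n \<inter> \<Inter>(arrAB b n) = param_flat b n 0"
proof -
  have "{H \<in> arrAB b n. {0} \<subseteq> H} = arrAB b n"
    using subspace_arrB arrAB_subset_arrB fs.subspace_0 by blast
  then show ?thesis using flat_hull_arrAB[of 0 n b] by (simp add: flat_hull_def ambient_def)
qed

text \<open>The bottom is the flat of the origin: no representative remains in type B, and exactly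
  one, the common value of all coordinates, for the braid arrangement with
  \<open>n > 0\<close>.\<close>

lemma vdim_eq_bottom_iff:
  assumes "X \<in> flats n (arrAB b n)" "b \<or> n > 0"
  shows "vdim X = (if b then 0 else 1) \<longleftrightarrow> X = ambient n \<inter> \<Inter>(arrAB b n)"
proof -
  obtain v where v: "v \<in> ambient n" "X = param_flat b n v" using flat_arrAB_cases[OF assms(1)] .
  have "0 = param b n v (\<lambda>_. 0)" by (simp add: param_def fun_eq_iff)
  then have *: "param_flat b n 0 = param_flat b n v \<longleftrightarrow>
      inj_on (\<lambda>_. gabs b 0) (reps b n v) \<and> (\<forall>r\<in>reps b n v. gsgn b 0 \<noteq> 0)"
    using param_flat_param_eq_iff[OF v(1), of b "\<lambda>_. 0"] by simp
  have "param_flat b n 0 = param_flat b n v \<longleftrightarrow> card (reps b n v) = (if b then 0 else 1)"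
  proof (cases b)
    case True
    then show ?thesis unfolding * using finite_reps[of b n v] by (auto simp: gsgn_def)
  next
    case False
    then have "gabs b (v 0) \<in> reps b n v" using assms(2) by (intro in_repsI) (auto simp: gsgn_def)
    then have "inj_on (\<lambda>_. gabs b 0) (reps b n v) \<longleftrightarrow> card (reps b n v) = 1"
      by (auto simp: inj_on_def card_1_singleton_iff)
    then show ?thesis unfolding * using False by (simp add: gsgn_def)
  qed
  then show ?thesis unfolding v(2) vdim_param_flat Inter_arrAB_eq by metis
qed

lemma of_int_abs_poly: "real_of_int \<bar>k\<bar> = real m \<Longrightarrow> of_int \<bar>k\<bar> = (of_nat m :: real poly)"
  by (metis of_int_eq_iff of_int_of_nat_eq)

lemma charP_arrAB:
  assumes "b \<or> n > 0"
  shows "charP n (arrAB b n) = (\<Sum>X\<in>flats n (arrAB b n). of_nat (abs_mobius b (vdim X)) * [:-1, 1:] ^ (n - vdim X))"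
  unfolding charP_def
proof (intro sum.cong refl)
  fix X assume X: "X \<in> flats n (arrAB b n)"
  have "real_of_int (mobius (flats n (arrAB b n)) (ambient n \<inter> \<Inter>(arrAB b n)) X)
      = coeff (injpoly b (vdim X)) (if b then 0 else 1)"
    using X assms
    by (intro mobius_eq_coeff[where S = "grid b n" and t = "\<lambda>q. real (card (vals b q))" and p = "\<lambda>X. injpoly b (vdim X)"])
       (simp_all add: finite_arrAB finite_grid grid_subset_ambient inj_card_vals card_flat_Int_grid
          card_grid_flat_hull poly_injpoly vdim_eq_bottom_iff)
  then have "real_of_int \<bar>mobius (flats n (arrAB b n)) (ambient n \<inter> \<Inter>(arrAB b n)) X\<bar> = real (abs_mobius b (vdim X))"
    using abs_coeff_injpoly[of b] by (simp only: of_int_abs)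
  from of_int_abs_poly[OF this] show "of_int \<bar>mobius (flats n (arrAB b n)) (ambient n \<inter> \<Inter>(arrAB b n)) X\<bar> * [:-1, 1:] ^ (n - vdim X)
      = (of_nat (abs_mobius b (vdim X)) * [:-1, 1:] ^ (n - vdim X) :: real poly)"
    by (simp only:)
qed

text \<open>\<open>card_flat_Int\<close> for the whole space: each grid point is counted once, at
  its least flat.\<close>

lemma sum_injections: "(\<Sum>X\<in>flats n (arrAB b n). injections b (vdim X) q) = card (vals b q) ^ n"
proof -
  have "card (vals b q) ^ n = card (grid b n q)" by (simp add: grid_def card_box)
  also have "grid b n q = ambient n \<inter> grid b n q" using grid_subset_ambient by blast
  also have "card \<dots> = (\<Sum>X\<in>{Y\<in>flats n (arrAB b n). Y \<subseteq> ambient n}. card {u \<in> grid b n q. flat_hull n (arrAB b n) {u} = X})"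
    by (intro card_flat_Int finite_arrAB finite_grid grid_subset_ambient ambient_in_flats)
  also have "\<dots> = (\<Sum>X\<in>flats n (arrAB b n). injections b (vdim X) q)"
    using flat_subset_ambient by (intro sum.cong) (auto simp: card_grid_flat_hull)
  finally show ?thesis by simp
qed

subsection \<open>Flats of type D\<close>

definition zeros :: "nat \<Rightarrow> (nat \<Rightarrow> real) \<Rightarrow> nat set" where
  "zeros n w = {i. i < n \<and> w i = 0}"

abbreviation flatsB :: "nat \<Rightarrow> (nat \<Rightarrow> real) set set" where
  "flatsB n \<equiv> flats n (arrAB True n)"

abbreviation flatsD :: "nat \<Rightarrow> (nat \<Rightarrow> real) set set" where
  "flatsD n \<equiv> flats n (arrD n)"

abbreviation hullD :: "nat \<Rightarrow> (nat \<Rightarrow> real) set \<Rightarrow> (nat \<Rightarrow> real) set" where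
  "hullD n \<equiv> flat_hull n (arrD n)"

lemma arrD_subset_arrAB: "arrD n \<subseteq> arrAB True n"
  using arrD_subset_arrB by (simp add: arrAB_def)

lemma flatsD_subset_flatsB: "flatsD n \<subseteq> flatsB n"
  by (rule flats_mono[OF arrD_subset_arrAB])

section \<open>Type D hulls of points\<close>

lemma arrDE:
  assumes "H \<in> arrD n"
  obtains (eq) i j where "i < j" "j < n" "H = {v \<in> ambient n. v i = v j}"
    | (neg) i j where "i < j" "j < n" "H = {v \<in> ambient n. v i = - v j}"
  using assms unfolding arrD_def by blast

lemma hullD_memD:
  assumes "u \<in> hullD n {w}" "w \<in> ambient n" "i < j" "j < n"
  shows "w i = w j \<Longrightarrow> u i = u j" "w i = - w j \<Longrightarrow> u i = - u j"
proof -
  have H: "u \<in> H" if "H \<in> arrD n" "w \<in> H" for H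
    using assms(1) that by (simp add: flat_hull_def)
  show "u i = u j" if "w i = w j"
  proof -
    have "{v \<in> ambient n. v i = v j} \<in> arrD n" using assms(3,4) unfolding arrD_def by blast
    from H[OF this] show ?thesis using that assms(2) by simp
  qed
  show "u i = - u j" if "w i = - w j"
  proof -
    have "{v \<in> ambient n. v i = - v j} \<in> arrD n" using assms(3,4) unfolding arrD_def by blast
    from H[OF this] show ?thesis using that assms(2) by simp
  qed
qed

text \<open>The type B hyperplanes missing from type D are the \<open>x_i = 0\<close>; those through
  \<open>w\<close> have \<open>i\<close> in \<open>zeros n w\<close>, where \<open>u\<close>
  vanishes by assumption.\<close>

lemma hullD_subset_param_flat:
  assumes w: "w \<in> ambient n" and u: "u \<in> hullD n {w}" and z: "\<And>i. i \<in> zeros n w \<Longrightarrow> u i = 0"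
  shows "u \<in> param_flat True n w"
proof -
  have "u \<in> H" if H: "H \<in> arrB n" "w \<in> H" for H
  proof (cases "H \<in> arrD n")
    case True
    then show ?thesis using u H by (simp add: flat_hull_def)
  next
    case False
    then obtain i where i: "i < n" "H = {v \<in> ambient n. v i = 0}"
      using H(1) unfolding arrB_def arrD_def by blast
    then have "u i = 0" using H(2) by (intro z) (simp add: zeros_def)
    moreover have "u \<in> ambient n" using u by (simp add: flat_hull_def)
    ultimately show ?thesis using i by simp
  qed
  then show ?thesis
    using u unfolding flat_hull_arrAB[OF w, symmetric] by (simp add: flat_hull_def arrAB_def)
qed

text \<open>If \<open>w\<close> has two zeros \<open>i\<close> and \<open>j\<close>, the hyperplanes
  \<open>x_i = x_j\<close> and \<open>x_i = - x_j\<close> both pass through \<open>w\<close> and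
  force these coordinates to vanish; with no zeros nothing has to be forced.\<close>

lemma hullD_eq_param_flat:
  assumes w: "w \<in> ambient n" and z: "card (zeros n w) \<noteq> 1"
  shows "hullD n {w} = param_flat True n w"
proof
  show "param_flat True n w \<subseteq> hullD n {w}"
    unfolding flat_hull_arrAB[OF w, symmetric] using arrD_subset_arrAB by (auto simp: flat_hull_def)
  show "hullD n {w} \<subseteq> param_flat True n w"
  proof
    fix u assume u: "u \<in> hullD n {w}"
    have "u i = 0" if i: "i \<in> zeros n w" for i
    proof -
      have "zeros n w \<noteq> {i}" using z by auto
      then obtain j where j: "j \<in> zeros n w" "j \<noteq> i" using i by auto
      then consider "i < j" | "j < i" by linarith
      then show ?thesis
      proof cases
        case 1
        then show ?thesis using hullD_memD[OF u w 1] i j by (simp add: zeros_def)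
      next
        case 2
        then show ?thesis using hullD_memD[OF u w 2] i j by (simp add: zeros_def)
      qed
    qed
    then show "u \<in> param_flat True n w" by (rule hullD_subset_param_flat[OF w u])
  qed
qed

lemma param_flat_nth_zero: "u \<in> param_flat True n w \<Longrightarrow> w i = 0 \<Longrightarrow> u i = 0"
  by (auto simp: param_flat_def param_def gsgn_def)

text \<open>No type D hyperplane through \<open>w\<close> involves a sole zero coordinate, since it
  would make a second coordinate zero. So this coordinate is free in the hull.\<close>

lemma upd_in_hullD:
  assumes w: "w \<in> ambient n" and z: "zeros n w = {i}"
  shows "w(i := c) \<in> hullD n {w}"
proof -
  have i: "i < n" "w i = 0" and nz: "\<And>j. j < n \<Longrightarrow> j \<noteq> i \<Longrightarrow> w j \<noteq> 0"
    using z by (auto simp: zeros_def)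
  have amb: "w(i := c) \<in> ambient n" using w i by (simp add: ambient_def)
  have "w(i := c) \<in> H" if "H \<in> arrD n" "w \<in> H" for H
    using that(1)
  proof (cases rule: arrDE)
    case (eq j k)
    then have "j \<noteq> i" "k \<noteq> i" using that(2) nz[of j] nz[of k] i by auto
    then show ?thesis using eq that(2) amb by simp
  next
    case (neg j k)
    then have "j \<noteq> i" "k \<noteq> i" using that(2) nz[of j] nz[of k] i by auto
    then show ?thesis using neg that(2) amb by simp
  qed
  then show ?thesis using amb by (simp add: flat_hull_def)
qed

lemma param_flat_in_flatsD_iff:
  assumes w: "w \<in> ambient n"
  shows "param_flat True n w \<in> flatsD n \<longleftrightarrow> card (zeros n w) \<noteq> 1"
proof
  assume D: "param_flat True n w \<in> flatsD n"
  show "card (zeros n w) \<noteq> 1"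
  proof
    assume "card (zeros n w) = 1"
    then obtain i where i: "zeros n w = {i}" by (auto simp: card_1_singleton_iff)
    have "hullD n {w} \<subseteq> param_flat True n w"
      using flat_hull_subset[OF D, of "{w}"] in_param_flat_self[OF w] by simp
    then have "w(i := 1) \<in> param_flat True n w" using upd_in_hullD[OF w i] by blast
    moreover have "w i = 0" using i by (auto simp: zeros_def)
    ultimately show False using param_flat_nth_zero by fastforce
  qed
next
  assume "card (zeros n w) \<noteq> 1"
  then show "param_flat True n w \<in> flatsD n"
    using hullD_eq_param_flat[OF w] flat_hull_in_flats by metis
qed

text \<open>Giving the free coordinate a generic value keeps the type D hull and leaves no zeros, so
  the hull is a type B flat with one more representative.\<close>

lemma vdim_hullD_singleton_zero:
  assumes w: "w \<in> ambient n" and z: "zeros n w = {i}"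
  shows "vdim (hullD n {w}) = Suc (vdim (param_flat True n w))"
proof -
  have i: "i < n" "w i = 0" and nz: "\<And>j. j < n \<Longrightarrow> j \<noteq> i \<Longrightarrow> w j \<noteq> 0"
    using z by (auto simp: zeros_def)
  \<comment> \<open>\<open>c\<close> exceeds every absolute value in \<open>w\<close>, so coordinate
    \<open>i\<close> of \<open>w'\<close> agrees with no other one, even up to sign.\<close>
  define c where "c = 1 + (\<Sum>j<n. \<bar>w j\<bar>)"
  have "(\<Sum>j<n. \<bar>w j\<bar>) \<ge> 0" by (intro sum_nonneg) simp
  then have c: "c > 0" unfolding c_def by linarith
  have fresh: "\<bar>w j\<bar> < c" if "j < n" for j
  proof -
    have "\<bar>w j\<bar> \<le> (\<Sum>j<n. \<bar>w j\<bar>)" using that by (intro member_le_sum) auto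
    then show ?thesis by (simp add: c_def)
  qed
  define w' where "w' = w(i := c)"
  have w': "w' \<in> ambient n" using w i by (simp add: w'_def ambient_def)
  have z': "zeros n w' = {}" using nz c by (auto simp: zeros_def w'_def)
  have "w \<in> hullD n {w'}"
  proof -
    have "w \<in> H" if "H \<in> arrD n" "w' \<in> H" for H
      using that(1)
    proof (cases rule: arrDE)
      case (eq j k)
      then have "j \<noteq> i" "k \<noteq> i" using that(2) fresh[of j] fresh[of k] c by (auto simp: w'_def split: if_splits)
      then show ?thesis using eq that(2) w by (simp add: w'_def)
    next
      case (neg j k)
      then have "j \<noteq> i" "k \<noteq> i" using that(2) fresh[of j] fresh[of k] c by (auto simp: w'_def split: if_splits)
      then show ?thesis using neg that(2) w by (simp add: w'_def)
    qed
    then show ?thesis using w by (simp add: flat_hull_def)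
  qed
  then have "hullD n {w} = hullD n {w'}"
    using flat_hull_subset[OF flat_hull_in_flats, of "{w}" n "arrD n" "{w'}"]
      flat_hull_subset[OF flat_hull_in_flats, of "{w'}" n "arrD n" "{w}"]
      upd_in_hullD[OF w z, of c] by (simp add: w'_def)
  also have "\<dots> = param_flat True n w'" using z' by (intro hullD_eq_param_flat[OF w']) simp
  finally have "vdim (hullD n {w}) = card (reps True n w')" by (simp add: vdim_param_flat)
  moreover have "reps True n w' = insert c (reps True n w)"
  proof (intro equalityI subsetI)
    fix x assume "x \<in> reps True n w'"
    then obtain j where j: "j < n" "x = \<bar>w' j\<bar>" "w' j \<noteq> 0"
      by (auto simp: reps_def gsgn_def gabs_def sgn_0_0)
    show "x \<in> insert c (reps True n w)"
    proof (cases "j = i")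
      case True
      then show ?thesis using j c by (simp add: w'_def)
    next
      case False
      then show ?thesis using j in_repsI[of j n True w] by (simp add: w'_def gsgn_def gabs_def sgn_0_0)
    qed
  next
    fix x assume "x \<in> insert c (reps True n w)"
    then consider "x = c" | j where "j < n" "x = \<bar>w j\<bar>" "w j \<noteq> 0"
      by (auto simp: reps_def gsgn_def gabs_def sgn_0_0)
    then show "x \<in> reps True n w'"
    proof cases
      case 1
      then show ?thesis using in_repsI[of i n True w'] i c by (simp add: w'_def gsgn_def gabs_def sgn_0_0)
    next
      case 2
      then have "j \<noteq> i" using i by auto
      then show ?thesis using 2 in_repsI[of j n True w'] by (simp add: w'_def gsgn_def gabs_def sgn_0_0)
    qed
  qed
  moreover have "c \<notin> reps True n w"
    using fresh by (force simp: reps_def gabs_def)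
  ultimately show ?thesis by (simp add: vdim_param_flat finite_reps)
qed

section \<open>Type B flats that are not type D flats\<close>

lemma non_flatD_cases:
  assumes "Y \<in> flatsB n - flatsD n"
  obtains w i where "w \<in> ambient n" "Y = param_flat True n w" "zeros n w = {i}" "hullD n Y = hullD n {w}"
proof -
  obtain w where w: "w \<in> ambient n" "Y = param_flat True n w" using assms flat_arrAB_cases by blast
  then have "card (zeros n w) = 1" using assms param_flat_in_flatsD_iff by blast
  then obtain i where i: "zeros n w = {i}" by (auto simp: card_1_singleton_iff)
  have "hullD n Y = hullD n {w}"
    using flat_hull_flat_hull[OF arrD_subset_arrAB[of n], of "{w}" n] w flat_hull_arrAB[OF w(1), of True] by simp
  then show thesis using that w i by blast
qed

lemma vdim_hullD: "Y \<in> flatsB n - flatsD n \<Longrightarrow> vdim (hullD n Y) = Suc (vdim Y)"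
  by (metis non_flatD_cases vdim_hullD_singleton_zero)

lemma hullD_flatD: "X \<in> flatsD n \<Longrightarrow> hullD n X = X"
  using flat_hull_subset[of X n "arrD n" X] subset_flat_hull[of X n "arrD n"] flat_subset_ambient by blast

text \<open>Each such \<open>Y\<close> is \<open>X\<close> cut by \<open>x_i = 0\<close>, where
  coordinate \<open>i\<close> of the generic point \<open>v\<close> of \<open>X\<close> is nonzero
  and shares its absolute value with no other. Distinct such \<open>i\<close> give distinct
  representatives of \<open>v\<close>.\<close>

lemma card_non_flatD_hullD_le:
  assumes X: "X \<in> flatsD n"
  shows "card {Y \<in> flatsB n - flatsD n. hullD n Y = X} \<le> vdim X"
proof -
  obtain v where v: "v \<in> ambient n" "X = param_flat True n v"
    using X flatsD_subset_flatsB flat_arrAB_cases by blast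
  define I where "I = {i. i < n \<and> v i \<noteq> 0 \<and> (\<forall>j<n. j \<noteq> i \<longrightarrow> \<bar>v j\<bar> \<noteq> \<bar>v i\<bar>)}"
  have finI: "finite I" by (simp add: I_def)
  have "{Y \<in> flatsB n - flatsD n. hullD n Y = X} \<subseteq> (\<lambda>i. {u \<in> X. u i = 0}) ` I"
  proof
    fix Y assume Y: "Y \<in> {Y \<in> flatsB n - flatsD n. hullD n Y = X}"
    then obtain w i where w: "w \<in> ambient n" "Y = param_flat True n w" "zeros n w = {i}" "X = hullD n {w}"
      using non_flatD_cases[of Y n] by blast
    have i: "i < n" "w i = 0" using w(3) by (auto simp: zeros_def)
    have "Y \<subseteq> X" using Y subset_flat_hull[of Y n "arrD n"] flat_subset_ambient by blast
    then have "Y = {u \<in> X. u i = 0}"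
      using param_flat_nth_zero i hullD_subset_param_flat[OF w(1)] w(2,3,4) by auto
    \<comment> \<open>\<open>X\<close> contains a point that is nonzero at \<open>i\<close>, so
      \<open>v i \<noteq> 0\<close>. A \<open>j\<close> with the same absolute value would make
      \<open>w j\<close> a second zero.\<close>
    moreover have "i \<in> I"
    proof -
      have "w(i := 1) \<in> param_flat True n v" using upd_in_hullD[OF w(1,3)] w(4) v(2) by blast
      then have vi: "v i \<noteq> 0" using param_flat_nth_zero[of "w(i := 1)" n v i] by auto
      have "w \<in> param_flat True n v" using subset_flat_hull[of "{w}" n "arrD n"] w(1,4) v(2) by auto
      then obtain f where f: "w = param True n v f" by (auto simp: param_flat_def)
      have "\<bar>v j\<bar> \<noteq> \<bar>v i\<bar>" if "j < n" "j \<noteq> i" for j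
      proof
        assume a: "\<bar>v j\<bar> = \<bar>v i\<bar>"
        have "w i = sgn (v i) * f \<bar>v i\<bar>" using f i(1) by (simp add: param_def gsgn_def gabs_def)
        then have "f \<bar>v i\<bar> = 0" using i(2) vi by (simp add: sgn_0_0)
        then have "w j = 0" using f that(1) a by (simp add: param_def gsgn_def gabs_def)
        then show False using w(3) that by (auto simp: zeros_def)
      qed
      then show ?thesis using vi i by (simp add: I_def)
    qed
    ultimately show "Y \<in> (\<lambda>i. {u \<in> X. u i = 0}) ` I" by blast
  qed
  then have "card {Y \<in> flatsB n - flatsD n. hullD n Y = X} \<le> card I"
    using finI by (meson card_image_le card_mono finite_imageI order_trans)
  also have "card I = card ((\<lambda>i. \<bar>v i\<bar>) ` I)"
    by (rule card_image[symmetric], rule inj_onI) (auto simp: I_def)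
  also have "\<dots> \<le> card (reps True n v)"
  proof (intro card_mono finite_reps image_subsetI)
    fix i assume "i \<in> I"
    then show "\<bar>v i\<bar> \<in> reps True n v"
      using in_repsI[of i n True v] by (simp add: I_def gsgn_def gabs_def sgn_0_0)
  qed
  finally show ?thesis by (simp add: v(2) vdim_param_flat)
qed

text \<open>Sort the points by their type B hull first; it determines the type D hull.\<close>

lemma card_grid_hullD:
  assumes X: "X \<in> flatsD n"
  shows "card {u \<in> grid True n q. hullD n {u} = X}
    = (\<Sum>Y\<in>{Y \<in> flatsB n. hullD n Y = X}. injections True (vdim Y) q)"
proof -
  let ?h = "\<lambda>u. flat_hull n (arrAB True n) {u}"
  have h: "hullD n (?h u) = hullD n {u}" if "u \<in> grid True n q" for u
    using that grid_subset_ambient[of True n q] by (intro flat_hull_flat_hull arrD_subset_arrAB) auto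
  have "{u \<in> grid True n q. hullD n {u} = X}
      = (\<Union>Y\<in>{Y \<in> flatsB n. hullD n Y = X}. {u \<in> grid True n q. ?h u = Y})"
    using h flat_hull_in_flats[of n "arrAB True n"] by auto
  also have "card \<dots> = (\<Sum>Y\<in>{Y \<in> flatsB n. hullD n Y = X}. card {u \<in> grid True n q. ?h u = Y})"
    using finite_flats[OF finite_arrAB] finite_grid by (intro card_UN_disjoint) auto
  also have "\<dots> = (\<Sum>Y\<in>{Y \<in> flatsB n. hullD n Y = X}. injections True (vdim Y) q)"
    by (intro sum.cong) (auto simp: card_grid_flat_hull)
  finally show ?thesis .
qed

section \<open>Moebius values of type D\<close>

lemma flatsB_hullD_eq:
  "X \<in> flatsD n \<Longrightarrow> {Y \<in> flatsB n. hullD n Y = X} = insert X {Y \<in> flatsB n - flatsD n. hullD n Y = X}"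
  using flatsD_subset_flatsB hullD_flatD by blast

lemma abs_mobius_True_Suc: "abs_mobius True (Suc k) = (2 * k + 1) * abs_mobius True k"
  by (simp add: abs_mobius_def)

text \<open>The exceptional \<open>Y\<close> have dimension one less than \<open>X\<close>, hence
  the opposite sign. With \<open>dim X = k + 1\<close> there are at most \<open>k + 1\<close> of
  them, each weighing \<open>(2k-1)!!\<close>, against \<open>(2k+1) (2k-1)!!\<close> for
  \<open>X\<close>, so the difference is nonnegative.\<close>

lemma abs_coeff_sum_injpoly:
  assumes X: "X \<in> flatsD n"
  shows "\<bar>coeff (\<Sum>Y\<in>{Y \<in> flatsB n. hullD n Y = X}. injpoly True (vdim Y)) 0\<bar>
    = real (abs_mobius True (vdim X)) - (\<Sum>Y\<in>{Y \<in> flatsB n - flatsD n. hullD n Y = X}. real (abs_mobius True (vdim Y)))"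
proof -
  let ?E = "{Y \<in> flatsB n - flatsD n. hullD n Y = X}"
  have fin: "finite ?E" using finite_flats[OF finite_arrAB[of True n], of n] by simp
  have dim: "vdim X = Suc (vdim Y)" if "Y \<in> ?E" for Y using that vdim_hullD[of Y n] by auto
  define S where "S = (\<Sum>Y\<in>?E. real (abs_mobius True (vdim Y)))"
  have "coeff (\<Sum>Y\<in>{Y \<in> flatsB n. hullD n Y = X}. injpoly True (vdim Y)) 0
      = coeff (injpoly True (vdim X)) 0 + (\<Sum>Y\<in>?E. coeff (injpoly True (vdim Y)) 0)"
    unfolding flatsB_hullD_eq[OF X] using fin X by (simp add: coeff_sum)
  also have "(\<Sum>Y\<in>?E. coeff (injpoly True (vdim Y)) 0) = (\<Sum>Y\<in>?E. - ((- 1) ^ vdim X) * real (abs_mobius True (vdim Y)))"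
    by (intro sum.cong refl) (simp add: coeff_injpoly_True dim)
  also have "\<dots> = - ((- 1) ^ vdim X) * S" by (simp add: S_def sum_distrib_left)
  finally have "\<bar>coeff (\<Sum>Y\<in>{Y \<in> flatsB n. hullD n Y = X}. injpoly True (vdim Y)) 0\<bar>
      = \<bar>(- 1) ^ vdim X * (real (abs_mobius True (vdim X)) - S)\<bar>"
    by (simp add: coeff_injpoly_True algebra_simps)
  also have "\<dots> = \<bar>real (abs_mobius True (vdim X)) - S\<bar>" by (simp add: abs_mult)
  also have "\<dots> = real (abs_mobius True (vdim X)) - S"
  proof -
    have "S \<le> real (abs_mobius True (vdim X))"
    proof (cases "vdim X")
      case 0
      then have "?E = {}" using dim by fastforce
      then show ?thesis by (simp only: S_def sum.empty)
    next
      case (Suc k)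
      have "S = (\<Sum>Y\<in>?E. real (abs_mobius True k))"
        unfolding S_def using dim Suc by (intro sum.cong refl) simp
      also have "\<dots> = real (card ?E) * real (abs_mobius True k)" by simp
      also have "\<dots> \<le> real (2 * k + 1) * real (abs_mobius True k)"
        using card_non_flatD_hullD_le[OF X] Suc by (intro mult_right_mono) auto
      finally show ?thesis by (simp only: Suc abs_mobius_True_Suc of_nat_mult)
    qed
    then show ?thesis by simp
  qed
  finally show ?thesis unfolding S_def .
qed

text \<open>The origin has \<open>n\<close> zero coordinates. For \<open>n = 1\<close> there are no
  type D hyperplanes and the left side is the whole line.\<close>

lemma Inter_arrD_eq:
  assumes "n \<noteq> 1"
  shows "ambient n \<inter> \<Inter>(arrD n) = ambient n \<inter> \<Inter>(arrAB True n)"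
proof -
  have "{H \<in> arrD n. {0} \<subseteq> H} = arrD n"
    using subspace_arrB arrD_subset_arrB fs.subspace_0 by blast
  then have "ambient n \<inter> \<Inter>(arrD n) = hullD n {0}" by (simp add: flat_hull_def)
  also have "\<dots> = param_flat True n 0"
    using assms by (intro hullD_eq_param_flat) (auto simp: ambient_def zeros_def)
  finally show ?thesis by (simp add: Inter_arrAB_eq)
qed

text \<open>The correction terms of all \<open>X\<close> are regrouped by \<open>Y\<close>, each
  \<open>Y\<close> belonging to \<open>X = hullD n Y\<close>. The codimension of \<open>X\<close> is
  \<open>n - Suc (vdim Y)\<close>.\<close>

lemma charP_arrD:
  assumes "n \<noteq> 1"
  shows "charP n (arrD n)
    = (\<Sum>X\<in>flatsD n. of_nat (abs_mobius True (vdim X)) * [:-1, 1:] ^ (n - vdim X))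
      - (\<Sum>Y\<in>flatsB n - flatsD n. of_nat (abs_mobius True (vdim Y)) * [:-1, 1:] ^ (n - Suc (vdim Y)))"
proof -
  let ?E = "\<lambda>X. {Y \<in> flatsB n - flatsD n. hullD n Y = X}"
  let ?m = "\<lambda>X. of_nat (abs_mobius True (vdim X)) :: real poly"
  let ?w = "\<lambda>k. [:-1, 1:] ^ (n - k) :: real poly"
  have "of_int \<bar>mobius (flatsD n) (ambient n \<inter> \<Inter>(arrD n)) X\<bar> = ?m X - (\<Sum>Y\<in>?E X. ?m Y)" (is "of_int \<bar>?\<mu>\<bar> = _")
    if X: "X \<in> flatsD n" for X
  proof -
    have "real_of_int ?\<mu> = coeff (\<Sum>Y\<in>{Y \<in> flatsB n. hullD n Y = X}. injpoly True (vdim Y)) 0"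
    proof (rule mobius_eq_coeff[where S = "grid True n" and t = "\<lambda>q. real (card (vals True q))"
            and p = "\<lambda>X. \<Sum>Y\<in>{Y \<in> flatsB n. hullD n Y = X}. injpoly True (vdim Y)"])
      fix X q assume X: "X \<in> flatsD n"
      then have XB: "X \<in> flatsB n" using flatsD_subset_flatsB by blast
      show "real (card (X \<inter> grid True n q)) = real (card (vals True q)) ^ vdim X"
        using card_flat_Int_grid[OF XB] by simp
      show "real (card {v \<in> grid True n q. hullD n {v} = X})
         = poly (\<Sum>Y\<in>{Y \<in> flatsB n. hullD n Y = X}. injpoly True (vdim Y)) (real (card (vals True q)))"
        by (simp add: card_grid_hullD[OF X] poly_sum poly_injpoly)
      show "vdim X = 0 \<longleftrightarrow> X = ambient n \<inter> \<Inter>(arrD n)"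
        using vdim_eq_bottom_iff[OF XB] Inter_arrD_eq[OF assms] by simp
    qed (use X finite_arrD finite_grid grid_subset_ambient inj_card_vals in auto)
    then have "real_of_int \<bar>?\<mu>\<bar> = real (abs_mobius True (vdim X)) - (\<Sum>Y\<in>?E X. real (abs_mobius True (vdim Y)))"
      using abs_coeff_sum_injpoly[OF X] by (simp only: of_int_abs)
    also have "\<dots> = real_of_int (int (abs_mobius True (vdim X)) - (\<Sum>Y\<in>?E X. int (abs_mobius True (vdim Y))))"
      by simp
    finally have "\<bar>?\<mu>\<bar> = int (abs_mobius True (vdim X)) - (\<Sum>Y\<in>?E X. int (abs_mobius True (vdim Y)))"
      by (simp only: of_int_eq_iff)
    then show ?thesis by (simp only: of_int_diff of_int_sum of_int_of_nat_eq)
  qed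
  then have "charP n (arrD n) = (\<Sum>X\<in>flatsD n. (?m X - (\<Sum>Y\<in>?E X. ?m Y)) * ?w (vdim X))"
    unfolding charP_def by (intro sum.cong refl) (simp only:)
  also have "\<dots> = (\<Sum>X\<in>flatsD n. ?m X * ?w (vdim X)) - (\<Sum>X\<in>flatsD n. \<Sum>Y\<in>?E X. ?m Y * ?w (vdim X))"
    by (simp add: left_diff_distrib sum_subtractf sum_distrib_right)
  also have "(\<Sum>X\<in>flatsD n. \<Sum>Y\<in>?E X. ?m Y * ?w (vdim X)) = (\<Sum>X\<in>flatsD n. \<Sum>Y\<in>?E X. ?m Y * ?w (Suc (vdim Y)))"
    by (intro sum.cong refl) (auto simp: vdim_hullD)
  also have "\<dots> = (\<Sum>Y\<in>flatsB n - flatsD n. ?m Y * ?w (Suc (vdim Y)))"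
    using finite_flats[OF finite_arrAB[of True n], of n] finite_flats[OF finite_arrD[of n], of n]
    by (intro sum.group) (auto simp: flat_hull_in_flats)
  finally show ?thesis .
qed

text \<open>The sum counts the grid points with exactly one zero coordinate: \<open>n\<close>
  positions for it, and \<open>2 * q\<close> nonzero values elsewhere.\<close>

lemma sum_injections_non_flatD:
  "(\<Sum>Y\<in>flatsB n - flatsD n. injections True (vdim Y) q) = n * (2 * q) ^ (n - 1)"
proof -
  let ?h = "\<lambda>u. flat_hull n (arrAB True n) {u}"
  let ?Z = "\<lambda>i j. if j = i then {0} else vals True q - {0}"
  have "(\<Sum>Y\<in>flatsB n - flatsD n. injections True (vdim Y) q)
      = (\<Sum>Y\<in>flatsB n - flatsD n. card {u \<in> grid True n q. ?h u = Y})"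
    by (intro sum.cong) (auto simp: card_grid_flat_hull)
  also have "\<dots> = card (\<Union>Y\<in>flatsB n - flatsD n. {u \<in> grid True n q. ?h u = Y})"
    using finite_flats[OF finite_arrAB[of True n], of n] finite_grid by (intro card_UN_disjoint[symmetric]) auto
  also have "(\<Union>Y\<in>flatsB n - flatsD n. {u \<in> grid True n q. ?h u = Y}) = {u \<in> grid True n q. card (zeros n u) = 1}"
  proof -
    have "?h u \<in> flatsB n - flatsD n \<longleftrightarrow> card (zeros n u) = 1" if "u \<in> grid True n q" for u
    proof -
      have u: "u \<in> ambient n" using that grid_subset_ambient by blast
      show ?thesis using param_flat_in_flatsD_iff[OF u] flat_hull_arrAB[OF u, of True] flat_hull_in_flats[of n "arrAB True n" "{u}"] by auto
    qed
    then show ?thesis by auto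
  qed
  also have "\<dots> = (\<Union>i<n. box n (?Z i))"
  proof (intro equalityI subsetI)
    fix u assume u: "u \<in> {u \<in> grid True n q. card (zeros n u) = 1}"
    then obtain i where i: "zeros n u = {i}" by (auto simp: card_1_singleton_iff)
    then have "i < n" "u i = 0" "\<And>j. j < n \<Longrightarrow> j \<noteq> i \<Longrightarrow> u j \<noteq> 0" by (auto simp: zeros_def)
    then have "u \<in> box n (?Z i)" using u by (simp add: grid_def box_def)
    then show "u \<in> (\<Union>i<n. box n (?Z i))" using \<open>i < n\<close> by blast
  next
    fix u assume "u \<in> (\<Union>i<n. box n (?Z i))"
    then obtain i where i: "i < n" "u \<in> box n (?Z i)" by blast
    have Z: "u j \<in> ?Z i j" if "j < n" for j using i(2) that unfolding box_def by blast
    have "zeros n u = {i}"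
    proof -
      have "u i = 0" using Z[OF i(1)] by simp
      moreover have "u j \<noteq> 0" if "j < n" "j \<noteq> i" for j using Z[OF that(1)] that(2) by simp
      ultimately show ?thesis using i(1) by (auto simp: zeros_def)
    qed
    moreover have "u j \<in> vals True q" if "j < n" for j
      using Z[OF that] zero_in_vals[of q] by (cases "j = i") auto
    ultimately show "u \<in> {u \<in> grid True n q. card (zeros n u) = 1}"
      using i(2) by (simp add: grid_def box_def)
  qed
  also have "card \<dots> = (\<Sum>i<n. card (box n (?Z i)))"
  proof (rule card_UN_disjoint)
    show "\<forall>i\<in>{..<n}. finite (box n (?Z i))" by (auto intro!: finite_box simp: finite_vals)
    show "\<forall>i\<in>{..<n}. \<forall>j\<in>{..<n}. i \<noteq> j \<longrightarrow> box n (?Z i) \<inter> box n (?Z j) = {}"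
      unfolding box_def by fastforce
  qed simp
  also have "\<dots> = (\<Sum>i<n. (2 * q) ^ (n - 1))"
  proof (rule sum.cong)
    fix i assume i: "i \<in> {..<n}"
    have "card (vals True q - {0}) = 2 * q"
      using zero_in_vals card_vals[of True q] finite_vals by (simp add: num_signs_def)
    then have "card (box n (?Z i)) = (\<Prod>j<n. if j = i then 1 else 2 * q)"
      unfolding card_box by (intro prod.cong) auto
    also have "\<dots> = (\<Prod>j\<in>{..<n} - {i}. 2 * q)"
      using i by (subst prod.remove[of _ i]) auto
    finally show "card (box n (?Z i)) = (2 * q) ^ (n - 1)" using i by simp
  qed simp
  finally show ?thesis by simp
qed

subsection \<open>Generating functions\<close>

lemma to_fract_of_nat: "to_fract (of_nat k) = of_nat k"
  by (induction k) simp_all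

lemma to_fract_power: "to_fract (x ^ k) = to_fract x ^ k"
  by (induction k) simp_all

lemma zvar_minus_1: "zvar - 1 = to_fract [:-1, 1:]"
proof -
  have "zvar - 1 = to_fract ([:0, 1:] - 1)" unfolding zvar_def to_fract_diff by simp
  then show ?thesis by (simp add: one_pCons)
qed

lemma zvar_minus_1_nonzero: "zvar - 1 \<noteq> 0"
  unfolding zvar_minus_1 by simp

text \<open>The series \<open>u = (e^(c(z-1)x) - 1) / (c(z-1))\<close>, chosen so that
  \<open>A(z, cx) = 1/(1 - c u)\<close>.\<close>

definition scaled_expm1 :: "nat \<Rightarrow> coef fps" where
  "scaled_expm1 c = fps_const (1 / (of_nat c * (zvar - 1))) * (fps_exp (of_nat c * (zvar - 1)) - 1)"

lemma scaled_expm1_nth_0: "scaled_expm1 c $ 0 = 0"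
  by (simp add: scaled_expm1_def)

lemma Afun_scaled_expm1:
  assumes "c > 0"
  shows "Afun (of_nat c) * (1 - fps_const (of_nat c) * scaled_expm1 c) = 1"
proof -
  let ?w = "zvar - 1" and ?e = "fps_exp (of_nat c * (zvar - 1)) :: coef fps"
  let ?g = "fps_const zvar - ?e"
  have g0: "?g $ 0 \<noteq> 0" using zvar_minus_1_nonzero by simp
  have "fps_const w * (1 - fps_const d * (fps_const (1 / (d * w)) * G)) = fps_const w - G"
    if "w \<noteq> 0" "d \<noteq> 0" for w d :: coef and G
    using that by (simp add: right_diff_distrib mult.assoc[symmetric])
  then have "fps_const ?w * (1 - fps_const (of_nat c) * scaled_expm1 c) = fps_const ?w - (?e - 1)"
    unfolding scaled_expm1_def using assms zvar_minus_1_nonzero by (metis not_gr_zero of_nat_eq_0_iff)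
  also have "\<dots> = ?g" by (simp flip: fps_const_sub fps_const_1_eq_1)
  finally have *: "fps_const ?w * (1 - fps_const (of_nat c) * scaled_expm1 c) = ?g" .
  have "Afun (of_nat c) * (1 - fps_const (of_nat c) * scaled_expm1 c)
      = inverse ?g * (fps_const ?w * (1 - fps_const (of_nat c) * scaled_expm1 c))"
    unfolding Afun_def using g0 by (simp add: fps_divide_unit mult_ac)
  also have "\<dots> = 1" unfolding * using g0 by (rule inverse_mult_eq_1)
  finally show ?thesis .
qed

lemma fps_log_Afun: "fps_log (Afun 1) = Abs_fps (\<lambda>k. of_nat (abs_mobius False k) / fact k) oo scaled_expm1 1"
  unfolding fps_log_def abs_mobius_def
  using fps_ln_compose_geometric[OF scaled_expm1_nth_0, of "Afun 1" 1] Afun_scaled_expm1[of 1] by simp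

lemma fps_sqrt_Afun: "fps_sqrt (Afun 2) = Abs_fps (\<lambda>k. of_nat (abs_mobius True k) / fact k) oo scaled_expm1 2"
  unfolding fps_sqrt_def abs_mobius_def
  using fps_binomial_half_compose[OF scaled_expm1_nth_0, of "Afun 2" 2] Afun_scaled_expm1[of 2] by simp

text \<open>\<open>E\<close> encodes the point count: 1 for \<open>q^n\<close>,
  \<open>fps_exp 1\<close> for \<open>(2q+1)^n\<close>, and \<open>fps_X\<close> for
  \<open>n (2q)^(n-1)\<close>.\<close>

lemma weighted_count_fps_nth:
  fixes E :: "coef fps"
  assumes "F \<subseteq> flats n (arrAB b n)"
    and "\<And>q. of_nat (\<Sum>Y\<in>F. injections b (vdim Y) q) = fact n * (E * fps_exp (of_nat (num_signs b * q))) $ n"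
  shows "(\<Sum>Y\<in>F. of_nat (abs_mobius b (vdim Y)) * (zvar - 1) ^ (n - vdim Y)) / fact n
     = ((E oo (fps_const (zvar - 1) * fps_X)) * (Abs_fps (\<lambda>k. of_nat (abs_mobius b k) / fact k) oo scaled_expm1 (num_signs b))) $ n"
  unfolding scaled_expm1_def
proof (rule weighted_count_eq_fps_nth)
  show "finite F" using assms(1) finite_flats[OF finite_arrAB] finite_subset by blast
  show "vdim Y \<le> n" if "Y \<in> F" for Y using that assms(1) vdim_flat_le by blast
  show "num_signs b > 0" by (simp add: num_signs_def)
  show "zvar - 1 \<noteq> 0" by (rule zvar_minus_1_nonzero)
  show "of_nat (\<Sum>Y\<in>F. num_signs b ^ vdim Y * fact (vdim Y) * (q choose vdim Y))
      = fact n * (E * fps_exp (of_nat (num_signs b * q))) $ n" for q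
    using assms(2) by (simp only: injections_def)
qed

lemma to_fract_weighted_sum:
  "to_fract (\<Sum>Y\<in>F. of_nat (f Y) * [:-1, 1:] ^ g Y) = (\<Sum>Y\<in>F. of_nat (f Y) * (zvar - 1) ^ g Y)"
  by (simp add: to_fract_of_nat to_fract_power zvar_minus_1)

lemma egf_PA: "egf PA = 1 + fps_log (Afun 1)"
proof (rule fps_ext)
  fix n
  show "egf PA $ n = (1 + fps_log (Afun 1)) $ n"
  proof (cases "n = 0")
    case True
    then show ?thesis by (simp add: egf_def PA_def fps_log_Afun abs_mobius_def)
  next
    case False
    have "egf PA $ n = (\<Sum>Y\<in>flats n (arrAB False n). of_nat (abs_mobius False (vdim Y)) * (zvar - 1) ^ (n - vdim Y)) / fact n"
      using False charP_arrAB[of False n]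
      by (simp add: egf_def PA_def arrAB_def to_fract_weighted_sum del: to_fract_sum)
    also have "\<dots> = ((1 oo (fps_const (zvar - 1) * fps_X)) * (Abs_fps (\<lambda>k. of_nat (abs_mobius False k) / fact k) oo scaled_expm1 (num_signs False))) $ n"
      by (rule weighted_count_fps_nth) (simp_all add: sum_injections card_vals del: of_nat_sum)
    also have "\<dots> = (1 + fps_log (Afun 1)) $ n"
      using False by (simp add: fps_log_Afun num_signs_def)
    finally show ?thesis .
  qed
qed

lemma weighted_sum_flatsB:
  "(\<Sum>Y\<in>flatsB n. of_nat (abs_mobius True (vdim Y)) * (zvar - 1) ^ (n - vdim Y)) / fact n
    = (fps_exp (zvar - 1) * fps_sqrt (Afun 2)) $ n"
proof -
  have "(\<Sum>Y\<in>flatsB n. of_nat (abs_mobius True (vdim Y)) * (zvar - 1) ^ (n - vdim Y)) / fact n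
    = ((fps_exp 1 oo (fps_const (zvar - 1) * fps_X)) * (Abs_fps (\<lambda>k. of_nat (abs_mobius True k) / fact k) oo scaled_expm1 (num_signs True))) $ n"
  proof (rule weighted_count_fps_nth)
    fix q
    show "of_nat (\<Sum>Y\<in>flatsB n. injections True (vdim Y) q)
        = fact n * (fps_exp 1 * fps_exp (of_nat (num_signs True * q)) :: coef fps) $ n"
      by (simp add: sum_injections card_vals flip: fps_exp_add_mult del: of_nat_sum)
  qed simp
  then show ?thesis by (simp add: fps_sqrt_Afun num_signs_def)
qed

lemma egf_PB: "egf PB = fps_exp (zvar - 1) * fps_sqrt (Afun 2)"
proof (rule fps_ext)
  fix n
  \<comment> \<open>The convention \<open>PB 0 = 1\<close> agrees with the sum over the single flat
    of dimension 0.\<close>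
  have "PB n = (\<Sum>X\<in>flatsB n. of_nat (abs_mobius True (vdim X)) * [:-1, 1:] ^ (n - vdim X))"
  proof (cases "n = 0")
    case True
    have "flats 0 (arrAB True 0) = {ambient 0}" by (auto simp: flats_def arrAB_def arrB_def)
    moreover have "vdim (ambient 0) = 0" using vdim_flat_le[of "ambient 0" 0 True] ambient_in_flats by simp
    ultimately show ?thesis using True by (simp add: PB_def abs_mobius_def)
  next
    case False
    then show ?thesis using charP_arrAB[of True n] by (simp add: PB_def arrAB_def)
  qed
  then show "egf PB $ n = (fps_exp (zvar - 1) * fps_sqrt (Afun 2)) $ n"
    using weighted_sum_flatsB[of n] by (simp add: egf_def to_fract_weighted_sum del: to_fract_sum)
qed

lemma weighted_sum_non_flatD:
  "(\<Sum>Y\<in>flatsB n - flatsD n. of_nat (abs_mobius True (vdim Y)) * (zvar - 1) ^ (n - vdim Y)) / fact n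
    = (zvar - 1) * (fps_X * fps_sqrt (Afun 2)) $ n"
proof -
  have "(\<Sum>Y\<in>flatsB n - flatsD n. of_nat (abs_mobius True (vdim Y)) * (zvar - 1) ^ (n - vdim Y)) / fact n
    = ((fps_X oo (fps_const (zvar - 1) * fps_X)) * (Abs_fps (\<lambda>k. of_nat (abs_mobius True k) / fact k) oo scaled_expm1 (num_signs True))) $ n"
  proof (rule weighted_count_fps_nth)
    fix q
    show "of_nat (\<Sum>Y\<in>flatsB n - flatsD n. injections True (vdim Y) q)
        = fact n * (fps_X * fps_exp (of_nat (num_signs True * q)) :: coef fps) $ n"
      by (cases n) (simp_all add: sum_injections_non_flatD num_signs_def field_simps del: of_nat_sum)
  qed blast
  then show ?thesis by (simp add: fps_sqrt_Afun num_signs_def mult.assoc)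
qed

text \<open>The square root begins \<open>1 + x\<close>, so the coefficient is
  \<open>(z - 1) - z + 1\<close>, matching the convention for \<open>PD 1\<close>.\<close>

lemma egf_PD_nth_1:
  "((fps_exp (zvar - 1) - fps_const zvar * fps_X) * fps_sqrt (Afun 2)) $ 1 = 0"
proof -
  have "fps_sqrt (Afun 2) $ 0 = 1" by (simp add: fps_sqrt_Afun abs_mobius_def)
  moreover have "fps_sqrt (Afun 2) $ 1 = 1"
    using zvar_minus_1_nonzero by (simp add: fps_sqrt_Afun fps_compose_nth abs_mobius_def scaled_expm1_def)
  ultimately show ?thesis by (simp add: fps_mult_nth)
qed

text \<open>Let \<open>b\<close> and \<open>e\<close> be the type B weighted sums over all flats and
  over the non-type-D ones. Then \<open>(z-1) PD = (z-1)(b - e) - e = (z-1) b - z e\<close>. As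
  \<open>e\<close> carries a factor \<open>z - 1\<close>, this factor cancels.\<close>

lemma egf_PD: "egf PD = (fps_exp (zvar - 1) - fps_const zvar * fps_X) * fps_sqrt (Afun 2)"
proof (rule fps_ext)
  fix n
  let ?S = "fps_sqrt (Afun 2)" and ?w = "zvar - 1"
  let ?W = "\<lambda>F e. (\<Sum>Y\<in>F. of_nat (abs_mobius True (vdim Y)) * ?w ^ (n - e (vdim Y)))"
  show "egf PD $ n = ((fps_exp ?w - fps_const zvar * fps_X) * ?S) $ n"
  proof (cases "n = 1")
    case True
    then show ?thesis using egf_PD_nth_1 by (simp add: egf_def PD_def)
  next
    case False
    have fin: "finite (flatsB n)" using finite_flats[OF finite_arrAB] .
    have "PD n = charP n (arrD n)"
    proof (cases "n = 0")
      case True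
      have "flats 0 (arrD 0) = {ambient 0}" by (auto simp: flats_def arrD_def)
      moreover have "flats 0 (arrAB True 0) = {ambient 0}" by (auto simp: flats_def arrAB_def arrB_def)
      moreover have "vdim (ambient 0) = 0" using vdim_flat_le[of "ambient 0" 0 True] ambient_in_flats by simp
      ultimately show ?thesis using True charP_arrD[of 0] by (simp add: PD_def abs_mobius_def)
    next
      case False
      then show ?thesis using \<open>n \<noteq> 1\<close> by (simp add: PD_def)
    qed
    then have PD: "to_fract (PD n) = ?W (flatsD n) id - ?W (flatsB n - flatsD n) Suc"
      by (simp only: charP_arrD[OF False] to_fract_diff to_fract_weighted_sum id_apply)
    have D: "?W (flatsD n) id = ?W (flatsB n) id - ?W (flatsB n - flatsD n) id"
      using sum.subset_diff[OF flatsD_subset_flatsB fin, of "\<lambda>Y. of_nat (abs_mobius True (vdim Y)) * ?w ^ (n - vdim Y)"] by simp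
    have *: "?w * ?W (flatsB n - flatsD n) Suc = ?W (flatsB n - flatsD n) id"
      unfolding sum_distrib_left
    proof (intro sum.cong refl)
      fix Y assume Y: "Y \<in> flatsB n - flatsD n"
      \<comment> \<open>The hull is a flat of dimension \<open>Suc (vdim Y)\<close>, so this number
        is at most \<open>n\<close> and the subtraction in the exponent is not truncated.\<close>
      have "hullD n Y \<in> flatsB n" using flat_hull_in_flats flatsD_subset_flatsB by blast
      then have "Suc (vdim Y) \<le> n" using vdim_hullD[OF Y] vdim_flat_le by metis
      then have "n - vdim Y = Suc (n - Suc (vdim Y))" by simp
      then show "?w * (of_nat (abs_mobius True (vdim Y)) * ?w ^ (n - Suc (vdim Y)))
          = of_nat (abs_mobius True (vdim Y)) * ?w ^ (n - id (vdim Y))"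
        by (simp add: mult_ac)
    qed
    have div: "w * (a / f) = w * (b / f) - z * (c / f)" if "w * a = w * b - z * c" for w a b z c f :: coef
      unfolding times_divide_eq_right that by (rule diff_divide_distrib)
    from * have "?w * to_fract (PD n) = ?w * ?W (flatsB n) id - zvar * ?W (flatsB n - flatsD n) id"
      unfolding PD D by (simp add: algebra_simps)
    then have "?w * (to_fract (PD n) / fact n)
        = ?w * (?W (flatsB n) id / fact n) - zvar * (?W (flatsB n - flatsD n) id / fact n)"
      by (rule div)
    also have "\<dots> = ?w * ((fps_exp ?w * ?S) $ n - zvar * (fps_X * ?S) $ n)"
      unfolding id_apply weighted_sum_flatsB weighted_sum_non_flatD by (simp add: algebra_simps)
    finally have "to_fract (PD n) / fact n = (fps_exp ?w * ?S) $ n - zvar * (fps_X * ?S) $ n"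
      by (rule mult_left_cancel[OF zvar_minus_1_nonzero, THEN iffD1])
    then show ?thesis by (simp add: egf_def left_diff_distrib mult.assoc)
  qed
qed

theorem theorem4p2:
  shows "egf PA = 1 + fps_log (Afun 1)
       \<and> egf PB = fps_exp (zvar - 1) * fps_sqrt (Afun 2)
       \<and> egf PD = (fps_exp (zvar - 1) - fps_const zvar * fps_X) * fps_sqrt (Afun 2)"
  using egf_PA egf_PB egf_PD by blast

end
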